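(* Let $\mathbf{T}_{CM}$ be a CM-estimate of the regression slopes based on a function $\rho$ satisfying A3 (with constants $b\in(0,1)$ and $c>0$), and suppose $H_o$ satisfies A1 and A2. Define $$r_{CM}(\varepsilon)=J_{CM}\big[(1-\varepsilon)F_{H_o,0,\mathbf{0}}+\varepsilon\delta_\infty\big]$$ and $$m_{CM}(t)=\inf_{\|\boldsymbol{\theta}\|=t}\ \inf_{\alpha\in\mathbb{R}}J_{CM}\big[(1-\varepsilon)F_{H_o,\alpha,\boldsymbol{\theta}}+\varepsilon\delta_0\big].$$ Then the maximum bias function $B_{CM}(\varepsilon)$ of $\mathbf{T}_{CM}$ is given by $$B_{CM}(\varepsilon)=m_{CM}^{-1}[r_{CM}(\varepsilon)].$$
   Context: Model. Let $(y,\mathbf{x})\in\mathbb{R}\times\mathbb{R}^p$ have joint distribution $H_o$ under which $y$ and $\mathbf{x}$ are independent, $y\sim F_o$ and $\mathbf{x}\sim G_o$ (this is the linear model $y=\alpha_o+\mathbf{x}'\boldsymbol{\theta}_o+u$ normalized, by equivariance, so that $\alpha_o=0$, $\boldsymbol{\theta}_o=\mathbf{0}$ and the scatter matrix of $\mathbf{x}$ is the identity). Conditions. A1: $F_o$ is absolutely continuous with density $f_o$ which is symmetric, continuous and strictly decreasing on $\mathbb{R}^+$. A2: $P_{G_o}(\mathbf{x}'\boldsymbol{\theta}=c)<1$ for every $\boldsymbol{\theta}\in\mathbb{R}^p$, $\boldsymbol{\theta}\ne\mathbf{0}$, and every $c\in\mathbb{R}$. A3 (for a function $\rho:\mathbb{R}\to[0,\infty)$):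 (i) $\rho$ is symmetric, nondecreasing on $[0,\infty)$, $\rho(0)=0$; (ii) $\rho$ is bounded with $\lim_{u\to\infty}\rho(u)=1$; (iii) $\rho$ has only finitely many discontinuities. Maximum bias. For $0<\varepsilon<1$, $V_\varepsilon=\{(1-\varepsilon)H_o+\varepsilon H^*: H^* \text{ any probability distribution on }\mathbb{R}^{p+1}\}$. For an $\mathbb{R}^p$-valued functional $\mathbf{T}$ (with $\mathbf{T}(H_o)=\mathbf{0}$, weakly continuous at $H_o$), the asymptotic bias at $H$ is $b(\mathbf{T},H)=\|\mathbf{T}(H)\|$ (Euclidean norm) if $\mathbf{T}(H)$ is defined and finite, and $b(\mathbf{T},H)=\infty$ otherwise; the maximum bias function is $B_{\mathbf{T}}(\varepsilon)=\sup\{b(\mathbf{T},H):H\in V_\varepsilon\}$. CM-estimates. Given $\rho$, $b\in(0,1)$ and $c>0$, the CM-estimates of intercept, slopes and scale $\{t_{CM}(H),\mathbf{T}_{CM}(H),\sigma_{CM}(H)\}$ are the solution $(\alpha,\boldsymbol{\theta},\sigma)$, $\sigma>0$, minimizing $c\,E_H[\rho((y-\alpha-\mathbf{x}'\boldsymbol{\theta})/\sigma)]+\log\sigma$ subject to the constraint $E_H[\rho((y-\alpha-\mathbf{x}'\boldsymbol{\theta})/\sigma)]\le b$. Notation. $F_{H,\alpha,\boldsymbol{\theta}}$ is the distribution function of $|y-\alpha-\mathbf{x}'\boldsymbol{\theta}|$ when $(y,\mathbf{x})\sim H$. $\delta_0$ and $\delta_\infty$ are the point masses at $0$ and at $+\infty$,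 with the convention $\rho(\infty)=1$. For a distribution $F$ on $[0,\infty]$, the M-scale $\sigma(F)$ is the solution of $E_F[\rho(y/\sigma(F))]=b$, and $$J_{CM}(F)=\inf_{s\ge\sigma(F)}\{c\,E_F[\rho(y/s)]+\log s\}.$$ $m_{CM}^{-1}(v)$ denotes the $t\ge0$ with $m_{CM}(t)=v$ (note that $m_{CM}$ depends on $\varepsilon$). The amount of contamination satisfies $0<\varepsilon<\min\{b,1-b\}$ and is such that the inverse value $m_{CM}^{-1}[r_{CM}(\varepsilon)]$ exists.
   Formalization: Where the CM minimization problem at H has no exact minimizer (possible for discontinuous ρ, and then the claim fails with bias ∞), the CM-estimate is taken as a limit, with σ>0, of a minimizing sequence of feasible triples. *)

theory Defs
  imports "HOL-Probability.Probability"
begin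

section \<open>Mixtures of measures\<close>

definition mixture :: "real \<Rightarrow> 'a measure \<Rightarrow> 'a measure \<Rightarrow> 'a measure" where
  "mixture \<epsilon> M N = measure_of (space M) (sets M)
     (\<lambda>A. ennreal (1 - \<epsilon>) * emeasure M A + ennreal \<epsilon> * emeasure N A)"

lemma space_mixture [simp]: "space (mixture \<epsilon> M N) = space M"
  by (simp add: mixture_def)

lemma sets_mixture [simp, measurable_cong]: "sets (mixture \<epsilon> M N) = sets M"
  by (simp add: mixture_def)

lemma emeasure_mixture:
  assumes "sets N = sets M" and A: "A \<in> sets M"
  shows "emeasure (mixture \<epsilon> M N) A = ennreal (1 - \<epsilon>) * emeasure M A + ennreal \<epsilon> * emeasure N A"
  unfolding mixture_def
proof (rule emeasure_measure_of_sigma)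
  let ?\<mu> = "\<lambda>A. ennreal (1 - \<epsilon>) * emeasure M A + ennreal \<epsilon> * emeasure N A"
  show "sigma_algebra (space M) (sets M)" ..
  show "positive (sets M) ?\<mu>" by (simp add: positive_def)
  show "countably_additive (sets M) ?\<mu>"
  proof (rule countably_additiveI)
    fix X :: "nat \<Rightarrow> 'a set"
    assume X: "range X \<subseteq> sets M" "disjoint_family X"
    have "(\<Sum>i. ?\<mu> (X i)) = ennreal (1 - \<epsilon>) * (\<Sum>i. emeasure M (X i)) + ennreal \<epsilon> * (\<Sum>i. emeasure N (X i))"
      by (simp add: suminf_add [symmetric])
    with X assms(1) show "(\<Sum>i. ?\<mu> (X i)) = ?\<mu> (\<Union>i. X i)"
      by (simp add: suminf_emeasure)
  qed
qed fact


section \<open>Conditions on the model and on the loss function\<close>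

definition A1 :: "real measure \<Rightarrow> bool" where
  "A1 Fo \<longleftrightarrow> (\<exists>f. Fo = density lborel (\<lambda>u. ennreal (f u)) \<and> (\<forall>u. 0 \<le> f u) \<and>
     (\<forall>u. f (- u) = f u) \<and> continuous_on UNIV f \<and> strict_antimono_on {0..} f)"

definition A2 :: "(real ^ 'p) measure \<Rightarrow> bool" where
  "A2 Go \<longleftrightarrow> (\<forall>\<theta> c. \<theta> \<noteq> 0 \<longrightarrow> measure Go {x. x \<bullet> \<theta> = c} < 1)"

definition A3 :: "(real \<Rightarrow> real) \<Rightarrow> bool" where
  "A3 \<rho> \<longleftrightarrow> (\<forall>u. 0 \<le> \<rho> u) \<and>
     (\<forall>u. \<rho> (- u) = \<rho> u) \<and> mono_on {0..} \<rho> \<and> \<rho> 0 = 0 \<and>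
     bounded (range \<rho>) \<and> (\<rho> \<longlongrightarrow> 1) at_top \<and>
     finite {u. \<not> isCont \<rho> u}"


section \<open>Contamination neighbourhood and maximum bias\<close>

definition contam_nbhd :: "(real \<times> (real ^ 'p)) measure \<Rightarrow> real \<Rightarrow> (real \<times> (real ^ 'p)) measure set" where
  "contam_nbhd Ho \<epsilon> = {mixture \<epsilon> Ho Hs | Hs. prob_space Hs \<and> sets Hs = sets borel}"

text \<open>A functional may be undefined at some distributions; there it takes the value \<open>None\<close>.\<close>

type_synonym 'p functional = "(real \<times> (real ^ 'p)) measure \<Rightarrow> (real ^ 'p) option"

definition asym_bias :: "('p::finite) functional \<Rightarrow> (real \<times> (real ^ 'p)) measure \<Rightarrow> ereal" where
  "asym_bias T H = (case T H of None \<Rightarrow> \<infinity> | Some \<theta> \<Rightarrow> ereal (norm \<theta>))"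

definition max_bias :: "(real \<times> (real ^ 'p)) measure \<Rightarrow> ('p::finite) functional \<Rightarrow> real \<Rightarrow> ereal" where
  "max_bias Ho T \<epsilon> = (SUP H \<in> contam_nbhd Ho \<epsilon>. asym_bias T H)"


section \<open>CM-estimates\<close>

definition mean_loss ::
  "(real \<Rightarrow> real) \<Rightarrow> (real \<times> (real ^ 'p)) measure \<Rightarrow> real \<times> (real ^ 'p) \<times> real \<Rightarrow> real" where
  "mean_loss \<rho> H = (\<lambda>(\<alpha>, \<theta>, \<sigma>). LINT (y, x)|H. \<rho> ((y - \<alpha> - x \<bullet> \<theta>) / \<sigma>))"

definition CM_feasible ::
  "(real \<Rightarrow> real) \<Rightarrow> real \<Rightarrow> (real \<times> (real ^ 'p)) measure \<Rightarrow> (real \<times> (real ^ 'p) \<times> real) set" where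
  "CM_feasible \<rho> b H = {(\<alpha>, \<theta>, \<sigma>). 0 < \<sigma> \<and> mean_loss \<rho> H (\<alpha>, \<theta>, \<sigma>) \<le> b}"

definition CM_objective ::
  "(real \<Rightarrow> real) \<Rightarrow> real \<Rightarrow> (real \<times> (real ^ 'p)) measure \<Rightarrow> real \<times> (real ^ 'p) \<times> real \<Rightarrow> real" where
  "CM_objective \<rho> c H = (\<lambda>(\<alpha>, \<theta>, \<sigma>). c * mean_loss \<rho> H (\<alpha>, \<theta>, \<sigma>) + ln \<sigma>)"

definition CM_minimizer ::
  "(real \<Rightarrow> real) \<Rightarrow> real \<Rightarrow> real \<Rightarrow> (real \<times> (real ^ 'p)) measure \<Rightarrow> real \<times> (real ^ 'p) \<times> real \<Rightarrow> bool" where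
  "CM_minimizer \<rho> b c H z \<longleftrightarrow> z \<in> CM_feasible \<rho> b H \<and>
     (\<forall>w \<in> CM_feasible \<rho> b H. CM_objective \<rho> c H z \<le> CM_objective \<rho> c H w)"

definition CM_limit_minimizer ::
  "(real \<Rightarrow> real) \<Rightarrow> real \<Rightarrow> real \<Rightarrow> (real \<times> (real ^ 'p)) measure \<Rightarrow> real \<times> (real ^ 'p) \<times> real \<Rightarrow> bool" where
  "CM_limit_minimizer \<rho> b c H z \<longleftrightarrow> 0 < snd (snd z) \<and>
     (\<exists>Z L. (\<forall>n. Z n \<in> CM_feasible \<rho> b H) \<and> Z \<longlonglongrightarrow> z \<and>
        (\<lambda>n. CM_objective \<rho> c H (Z n)) \<longlonglongrightarrow> L \<and>
        (\<forall>w \<in> CM_feasible \<rho> b H. L \<le> CM_objective \<rho> c H w))"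

text \<open>
  Condition \<open>A3\<close> allows jumps of \<open>\<rho>\<close>, without semicontinuity. The infimum of the CM-problem
  can then fail to be attained at contaminated distributions with atoms, e.g. for
  \<open>\<rho> u = (if \<bar>u\<bar> < 1 then 0 else 1)\<close> when the optimal fit places an atom at distance exactly
  \<open>\<sigma>\<close>. In that case, and only then, a solution is understood as a limit of a minimizing
  sequence. If \<open>\<rho>\<close> is lower semicontinuous (in particular, continuous), limits of minimizing
  sequences are minimizers and the second branch yields no further solutions.
\<close>

definition CM_solution ::
  "(real \<Rightarrow> real) \<Rightarrow> real \<Rightarrow> real \<Rightarrow> (real \<times> (real ^ 'p)) measure \<Rightarrow> real \<times> (real ^ 'p) \<times> real \<Rightarrow> bool" where
  "CM_solution \<rho> b c H z \<longleftrightarrow>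
     (if \<exists>w. CM_minimizer \<rho> b c H w then CM_minimizer \<rho> b c H z else CM_limit_minimizer \<rho> b c H z)"

text \<open>
  Solutions need not be unique: \<open>T\<close> is an arbitrary selection of slopes of solutions, undefined
  exactly at the distributions without a solution.
\<close>

definition CM_slope_estimate ::
  "(real \<Rightarrow> real) \<Rightarrow> real \<Rightarrow> real \<Rightarrow> ('p::finite) functional \<Rightarrow> bool" where
  "CM_slope_estimate \<rho> b c T \<longleftrightarrow> (\<forall>H. prob_space H \<and> sets H = sets borel \<longrightarrow>
     (case T H of
        None \<Rightarrow> \<not> (\<exists>z. CM_solution \<rho> b c H z)
      | Some \<theta> \<Rightarrow> (\<exists>\<alpha> \<sigma>. CM_solution \<rho> b c H (\<alpha>, \<theta>, \<sigma>))))"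


section \<open>The functional \<open>J\<close> and the bias equation\<close>

text \<open>Distributions on \<open>[0, \<infinity>]\<close> are measures on \<^typ>\<open>ennreal\<close>; \<open>\<rho>\<close> is extended by \<open>\<rho>(\<infinity>) = 1\<close>.\<close>

definition rho_ext :: "(real \<Rightarrow> real) \<Rightarrow> ennreal \<Rightarrow> real" where
  "rho_ext \<rho> y = (if y = \<infinity> then 1 else \<rho> (enn2real y))"

definition scale_loss :: "(real \<Rightarrow> real) \<Rightarrow> ennreal measure \<Rightarrow> real \<Rightarrow> real" where
  "scale_loss \<rho> F s = (LINT y|F. rho_ext \<rho> (y / ennreal s))"

definition is_M_scale :: "(real \<Rightarrow> real) \<Rightarrow> real \<Rightarrow> ennreal measure \<Rightarrow> real \<Rightarrow> bool" where
  "is_M_scale \<rho> b F s \<longleftrightarrow> 0 < s \<and> scale_loss \<rho> F s = b"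

definition M_scale :: "(real \<Rightarrow> real) \<Rightarrow> real \<Rightarrow> ennreal measure \<Rightarrow> real" where
  "M_scale \<rho> b F = (THE s. is_M_scale \<rho> b F s)"

text \<open>
  When the M-scale is not defined, \<open>J_CM\<close> is \<open>\<infinity>\<close>, so that no junk value of \<^const>\<open>M_scale\<close>
  enters. In the model below this concerns only \<open>\<rho>\<close> with a large jump at \<open>0\<close>.
\<close>

definition J_CM :: "(real \<Rightarrow> real) \<Rightarrow> real \<Rightarrow> real \<Rightarrow> ennreal measure \<Rightarrow> ereal" where
  "J_CM \<rho> b c F = (if \<exists>!s. is_M_scale \<rho> b F s
     then (INF s \<in> {M_scale \<rho> b F..}. ereal (c * scale_loss \<rho> F s + ln s)) else \<infinity>)"

definition abs_resid_dist ::
  "(real \<times> (real ^ 'p)) measure \<Rightarrow> real \<Rightarrow> real ^ 'p \<Rightarrow> ennreal measure" where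
  "abs_resid_dist H \<alpha> \<theta> = distr H borel (\<lambda>(y, x). ennreal \<bar>y - \<alpha> - x \<bullet> \<theta>\<bar>)"

definition r_CM ::
  "(real \<Rightarrow> real) \<Rightarrow> real \<Rightarrow> real \<Rightarrow> (real \<times> (real ^ 'p)) measure \<Rightarrow> real \<Rightarrow> ereal" where
  "r_CM \<rho> b c Ho \<epsilon> = J_CM \<rho> b c (mixture \<epsilon> (abs_resid_dist Ho 0 0) (return borel \<infinity>))"

definition m_CM ::
  "(real \<Rightarrow> real) \<Rightarrow> real \<Rightarrow> real \<Rightarrow> (real \<times> (real ^ 'p)) measure \<Rightarrow> real \<Rightarrow> real \<Rightarrow> ereal" where
  "m_CM \<rho> b c Ho \<epsilon> t = (INF \<theta> \<in> {\<theta>. norm \<theta> = t}. INF \<alpha>.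
     J_CM \<rho> b c (mixture \<epsilon> (abs_resid_dist Ho \<alpha> \<theta>) (return borel 0)))"

definition m_CM_inv ::
  "(real \<Rightarrow> real) \<Rightarrow> real \<Rightarrow> real \<Rightarrow> (real \<times> (real ^ 'p)) measure \<Rightarrow> real \<Rightarrow> ereal \<Rightarrow> real" where
  "m_CM_inv \<rho> b c Ho \<epsilon> v = (THE t. 0 \<le> t \<and> m_CM \<rho> b c Ho \<epsilon> t = v)"

end

theory Submission
  imports Defs
begin

text \<open>
  Let \<open>G \<alpha> \<theta> s\<close> be the mean loss under \<open>H\<^sub>o\<close>. By symmetry and unimodality of \<open>F\<^sub>o\<close> it increases
  when \<open>(\<alpha>, \<theta>)\<close> is scaled up and is smallest at \<open>(0, 0)\<close>, and \<open>J_CM\<close> of a contaminated residual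
  distribution is the infimum of \<open>c \<phi>(s) + ln s\<close> over \<open>\<phi>(s) \<le> b\<close>, where
  \<open>\<phi>(s) = (1 - \<epsilon>) G \<alpha> \<theta> s + \<epsilon> w\<close> with \<open>w = 0\<close> or \<open>w = 1\<close>. So \<open>m_CM\<close> is nondecreasing. At every
  contaminated distribution the CM-objective is at least \<open>m_CM(\<parallel>\<theta>\<parallel>)\<close> on the feasible set, while
  its infimum is at most \<open>r_CM\<close> because of the competitors \<open>(0, 0, s)\<close>. This bounds the slope of any
  solution, and compactness yields a solution. Conversely, if \<open>m_CM(t) < r_CM\<close>, a point mass far out
  on a hyperplane with slope of norm \<open>t\<close> makes an objective value below \<open>r_CM\<close> feasible, whereas
  every fit with a shorter slope has loss near 1 at that point and so does no better than about
  \<open>r_CM\<close>.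
\<close>

section \<open>Loss functions\<close>

lemma finite_imp_AE_lborel:
  fixes S :: "'a::euclidean_space set"
  assumes "finite S"
  shows "AE x in lborel. x \<notin> S"
  using AE_not_in[OF finite_imp_null_set_lborel[OF assms]] .

locale bounded_loss =
  fixes \<rho> :: "real \<Rightarrow> real"
  assumes A3: "A3 \<rho>"
begin

lemma rho_nonneg [simp]: "0 \<le> \<rho> u"
  and rho_minus [simp]: "\<rho> (- u) = \<rho> u"
  and rho_0 [simp]: "\<rho> 0 = 0"
  and rho_mono_on: "mono_on {0..} \<rho>"
  and rho_lim: "(\<rho> \<longlongrightarrow> 1) at_top"
  and finite_discont: "finite {u. \<not> isCont \<rho> u}"
  using A3 by (auto simp: A3_def)

lemma rho_abs: "\<rho> \<bar>u\<bar> = \<rho> u"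
  by (simp add: abs_if)

lemma rho_mono: "\<bar>u\<bar> \<le> \<bar>v\<bar> \<Longrightarrow> \<rho> u \<le> \<rho> v"
  using mono_onD[OF rho_mono_on, of "\<bar>u\<bar>" "\<bar>v\<bar>"] by (simp add: rho_abs)

lemma rho_le_1 [simp]: "\<rho> u \<le> 1"
proof (rule tendsto_lowerbound[OF rho_lim])
  show "\<forall>\<^sub>F v in at_top. \<rho> u \<le> \<rho> v"
    using eventually_ge_at_top[of "\<bar>u\<bar>"] by eventually_elim (auto intro: rho_mono)
qed simp

lemma rho_measurable [measurable]: "\<rho> \<in> borel_measurable borel"
proof -
  \<comment> \<open>\<open>\<rho>\<close> is nonincreasing on the left half-line; truncating its
    argument at 0 gives a function monotone on the whole line, and symmetry recovers
    \<open>\<rho>\<close> from absolute values.\<close>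
  have "mono (\<lambda>u. \<rho> (max 0 u))"
    by (auto intro!: monoI rho_mono)
  then have [measurable]: "(\<lambda>u. \<rho> (max 0 u)) \<in> borel_measurable borel"
    by (rule borel_measurable_mono)
  have "(\<lambda>u. \<rho> (max 0 \<bar>u\<bar>)) \<in> borel_measurable borel"
    by measurable
  then show ?thesis
    by (simp add: rho_abs max_def)
qed

lemma rho_antimono_scale:
  assumes "0 < s" "s \<le> s'"
  shows "\<rho> (u / s') \<le> \<rho> (u / s)"
  using assms by (intro rho_mono) (auto simp: abs_divide intro!: divide_left_mono)

lemma rho_tendsto_1:
  assumes "filterlim (\<lambda>n. \<bar>X n\<bar>) at_top F"
  shows "((\<lambda>n. \<rho> (X n)) \<longlongrightarrow> 1) F"
  using filterlim_compose[OF rho_lim assms] by (simp add: rho_abs)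

end

section \<open>The location-scale loss of a symmetric unimodal distribution\<close>

locale unimodal_loss = bounded_loss \<rho> + Fo: prob_space Fo
  for \<rho> :: "real \<Rightarrow> real" and Fo :: "real measure" +
  assumes A1: "A1 Fo"
begin

text \<open>The conditional mean loss given \<open>x\<close>, with \<open>a\<close> standing for
  \<open>\<alpha> + x \<bullet> \<theta>\<close>.\<close>

definition K :: "real \<Rightarrow> real \<Rightarrow> real" where
  "K a s = (LINT y|Fo. \<rho> ((y - a) / s))"

lemma sets_Fo [simp, measurable_cong]: "sets Fo = sets borel"
  using A1 by (auto simp: A1_def)

text \<open>Positivity comes from strict decrease: \<open>f\<close> exceeds its nonnegative value
  one unit further out.\<close>

lemma Fo_density:
  obtains f where "Fo = density lborel (\<lambda>u. ennreal (f u))" "\<And>u. 0 < f u" "\<And>u. f (- u) = f u"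
    "\<And>u v. \<bar>u\<bar> \<le> \<bar>v\<bar> \<Longrightarrow> f v \<le> f u" "f \<in> borel_measurable borel"
    "integrable lborel f"
proof -
  obtain f where f: "Fo = density lborel (\<lambda>u. ennreal (f u))" "\<And>u. 0 \<le> f u" "\<And>u. f (- u) = f u"
    "continuous_on UNIV f" "strict_antimono_on {0..} f"
    using A1 by (auto simp: A1_def)
  have f_abs: "f \<bar>u\<bar> = f u" for u
    using f(3) by (simp add: abs_if)
  have pos: "0 < f u" for u
  proof -
    have "f (\<bar>u\<bar> + 1) < f \<bar>u\<bar>"
      using f(5) by (auto simp: monotone_on_def)
    then show ?thesis using f(2)[of "\<bar>u\<bar> + 1"] by (simp add: f_abs)
  qed
  have anti: "f v \<le> f u" if "\<bar>u\<bar> \<le> \<bar>v\<bar>" for u v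
  proof (cases "\<bar>u\<bar> = \<bar>v\<bar>")
    case False
    then have "f \<bar>v\<bar> < f \<bar>u\<bar>"
      using f(5) that by (auto simp: monotone_on_def)
    then show ?thesis by (simp add: f_abs)
  qed (metis f_abs order_refl)
  have meas [measurable]: "f \<in> borel_measurable borel"
    using f(4) by (rule borel_measurable_continuous_onI)
  have "integrable (density lborel (\<lambda>u. ennreal (f u))) (\<lambda>_. 1 :: real)"
    using f(1) Fo.integrable_const by auto
  then have "integrable lborel f"
    by (subst (asm) integrable_density) (auto simp: f(2))
  with f(1) pos f(3) anti meas show ?thesis by (rule that)
qed

text \<open>An everywhere positive density gives \<open>Fo\<close> the null sets of Lebesgue
  measure, so finite exceptional sets of \<open>y\<close> can be ignored.\<close>

lemma AE_Fo: "(AE y in Fo. P y) \<longleftrightarrow> (AE y in lborel. P y)"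
proof -
  obtain f where f: "Fo = density lborel (\<lambda>u. ennreal (f u))" "\<And>u. 0 < f u"
    and [measurable]: "f \<in> borel_measurable borel"
    using Fo_density by blast
  show ?thesis
    unfolding f(1) by (subst AE_density) (auto simp: f(2))
qed

section \<open>Bounds, monotonicity and limits of the loss in location and scale\<close>

lemma rho_resid_integrable: "integrable Fo (\<lambda>y. \<rho> ((y - a) / s))"
  by (rule Fo.integrable_const_bound[where B = 1]) auto

lemma K_nonneg: "0 \<le> K a s"
  unfolding K_def by (rule Bochner_Integration.integral_nonneg) simp

lemma K_le_1: "K a s \<le> 1"
  unfolding K_def by (rule Fo.integral_le_const[OF rho_resid_integrable]) simp

lemma K_measurable [measurable]: "(\<lambda>a. K a s) \<in> borel_measurable borel"
proof -
  have "(\<lambda>(a, y). \<rho> ((y - a) / s)) \<in> borel_measurable (borel \<Otimes>\<^sub>M Fo)"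
    by measurable
  then show ?thesis
    unfolding K_def by (rule Fo.borel_measurable_lebesgue_integral)
qed

lemma K_antimono_scale: "0 < s \<Longrightarrow> s \<le> s' \<Longrightarrow> K a s' \<le> K a s"
  unfolding K_def by (intro integral_mono rho_resid_integrable rho_antimono_scale)

text \<open>Substitute \<open>- y\<close> for \<open>y\<close>; density and loss are both
  even.\<close>

lemma K_minus: "K (- a) s = K a s"
proof -
  obtain f where f: "Fo = density lborel (\<lambda>u. ennreal (f u))" "\<And>u. 0 < f u" "\<And>u. f (- u) = f u"
    and [measurable]: "f \<in> borel_measurable borel"
    using Fo_density by blast
  have K: "K a s = (LINT y|lborel. f y * \<rho> ((y - a) / s))" for a
    unfolding K_def unfolding f(1) by (rule integral_real_density) (auto simp: f(2) less_imp_le)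
  have "K a s = (LINT y|lborel. f (- y) * \<rho> ((- y - a) / s))"
    unfolding K using lborel_integral_real_affine[of "-1" "\<lambda>y. f y * \<rho> ((y - a) / s)" 0] by simp
  also have "\<dots> = K (- a) s"
  proof -
    have "\<rho> ((- y - a) / s) = \<rho> ((y - - a) / s)" for y
      using rho_minus[of "(y - - a) / s"] by (simp add: minus_divide_left)
    then show ?thesis
      unfolding K by (simp add: f(3))
  qed
  finally show ?thesis ..
qed

text \<open>
  Reflect at the midpoint \<open>m\<close> of \<open>a\<close> and \<open>a'\<close>. The difference of the two losses is odd around
  \<open>m\<close>, and its sign is that of the difference of the density and its reflection.
\<close>

lemma K_mono_nonneg:
  assumes "0 \<le> a" "a \<le> a'" "0 < s"
  shows "K a s \<le> K a' s"
proof -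
  obtain f where f: "Fo = density lborel (\<lambda>u. ennreal (f u))" "\<And>u. 0 < f u"
      "\<And>u v. \<bar>u\<bar> \<le> \<bar>v\<bar> \<Longrightarrow> f v \<le> f u"
    and [measurable]: "f \<in> borel_measurable borel" and int: "integrable lborel f"
    using Fo_density by blast
  define m where "m = (a + a') / 2"
  have m2: "2 * m = a + a'" by (simp add: m_def)
  define D where "D y = \<rho> ((y - a') / s) - \<rho> ((y - a) / s)" for y
  have [measurable]: "D \<in> borel_measurable borel"
    unfolding D_def by measurable
  have D_bound: "\<bar>D y\<bar> \<le> 1" for y
    unfolding D_def using rho_nonneg[of "(y - a') / s"] rho_nonneg[of "(y - a) / s"]
      rho_le_1[of "(y - a') / s"] rho_le_1[of "(y - a) / s"] by linarith
  have D_refl: "D (2 * m - y) = - D y" for y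
  proof -
    have "(2 * m - y - a') / s = - ((y - a) / s)" "(2 * m - y - a) / s = - ((y - a') / s)"
      unfolding m2 minus_divide_left by simp_all
    then show ?thesis by (simp add: D_def)
  qed
  have int1: "integrable lborel (\<lambda>y. f y * D y)"
  proof (rule Bochner_Integration.integrable_bound[OF int])
    show "AE y in lborel. norm (f y * D y) \<le> norm (f y)"
      using D_bound by (auto simp: abs_mult intro!: mult_left_le)
  qed simp
  have "integrable lborel (\<lambda>y. f (2 * m + -1 * y) * D (2 * m + -1 * y))"
    using lborel_integrable_real_affine[OF int1, of "-1" "2 * m"] by simp
  then have int2: "integrable lborel (\<lambda>y. f (2 * m - y) * D y)"
    using D_refl by simp
  have "K a' s - K a s = (LINT y|Fo. D y)"
    unfolding K_def D_def
    by (rule Bochner_Integration.integral_diff[symmetric]) (rule rho_resid_integrable)+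
  also have "\<dots> = (LINT y|lborel. f y * D y)"
    unfolding f(1) by (rule integral_real_density) (auto simp: f(2) less_imp_le)
  finally have 1: "K a' s - K a s = (LINT y|lborel. f y * D y)" .
  also have "\<dots> = (LINT y|lborel. f (2 * m + -1 * y) * D (2 * m + -1 * y))"
    using lborel_integral_real_affine[of "-1" "\<lambda>y. f y * D y" "2 * m"] by simp
  also have "\<dots> = - (LINT y|lborel. f (2 * m - y) * D y)"
    using D_refl by simp
  \<comment> \<open>Combining the integral with its reflected form leaves a product of two factors
    that never have opposite signs.\<close>
  finally have "2 * (K a' s - K a s) = (LINT y|lborel. f y * D y) - (LINT y|lborel. f (2 * m - y) * D y)"
    using 1 by simp
  also have "\<dots> = (LINT y|lborel. (f y - f (2 * m - y)) * D y)"
    using int1 int2 by (simp add: left_diff_distrib)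
  also have "\<dots> \<ge> 0"
  proof (rule Bochner_Integration.integral_nonneg)
    fix y
    show "0 \<le> (f y - f (2 * m - y)) * D y"
    proof (cases "m \<le> y")
      case True
      \<comment> \<open>As \<open>0 \<le> m\<close>, a point right of \<open>m\<close> is at least
        as far from 0 as its mirror image; it is also at least as close to \<open>a'\<close> as to
        \<open>a\<close>.\<close>
      have "\<bar>2 * m - y\<bar> \<le> \<bar>y\<bar>"
        using True assms m2 by arith
      moreover have "\<bar>y - a'\<bar> \<le> \<bar>y - a\<bar>"
        using True assms m2 by arith
      ultimately have "f y \<le> f (2 * m - y)" "D y \<le> 0"
        unfolding D_def using assms f(3) by (auto intro!: rho_mono divide_right_mono simp: abs_divide)
      then show ?thesis by (intro mult_nonpos_nonpos) auto
    next
      case False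
      have "\<bar>y\<bar> \<le> \<bar>2 * m - y\<bar>"
        using False assms m2 by arith
      moreover have "\<bar>y - a\<bar> \<le> \<bar>y - a'\<bar>"
        using False assms m2 by arith
      ultimately have "f (2 * m - y) \<le> f y" "0 \<le> D y"
        unfolding D_def using assms f(3) by (auto intro!: rho_mono divide_right_mono simp: abs_divide)
      then show ?thesis by auto
    qed
  qed
  finally show ?thesis by simp
qed

lemma K_mono:
  assumes "\<bar>a\<bar> \<le> \<bar>a'\<bar>" "0 < s"
  shows "K a s \<le> K a' s"
proof -
  have "K \<bar>u\<bar> s = K u s" for u
    by (simp add: abs_if K_minus)
  then show ?thesis
    using K_mono_nonneg[of "\<bar>a\<bar>" "\<bar>a'\<bar>" s] assms by simp
qed

text \<open>Integration smooths the jumps of \<open>\<rho>\<close>: pointwise convergence can fail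
  only where \<open>(y - a) / s\<close> is one of the finitely many discontinuities, a null set of
  \<open>y\<close>. Dominated convergence does the rest.\<close>

lemma K_tendsto_scale:
  assumes "S \<longlonglongrightarrow> s" "0 < s"
  shows "(\<lambda>n. K a (S n)) \<longlonglongrightarrow> K a s"
  unfolding K_def
proof (rule integral_dominated_convergence)
  have "AE y in lborel. y \<notin> (\<lambda>v. v * s + a) ` {u. \<not> isCont \<rho> u}"
    by (intro finite_imp_AE_lborel finite_imageI finite_discont)
  then show "AE y in Fo. (\<lambda>n. \<rho> ((y - a) / S n)) \<longlonglongrightarrow> \<rho> ((y - a) / s)"
    unfolding AE_Fo
  proof eventually_elim
    case (elim y)
    have "isCont \<rho> ((y - a) / s)"
    proof (rule ccontr)
      assume "\<not> ?thesis"
      then have "(y - a) / s * s + a \<in> (\<lambda>v. v * s + a) ` {u. \<not> isCont \<rho> u}"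
        by blast
      then show False using elim \<open>0 < s\<close> by simp
    qed
    moreover have "(\<lambda>n. (y - a) / S n) \<longlonglongrightarrow> (y - a) / s"
      using assms by (intro tendsto_intros) auto
    ultimately show ?case
      by (rule isCont_tendsto_compose)
  qed
  show "integrable Fo (\<lambda>_. 1 :: real)" by simp
qed auto

text \<open>As the scale shrinks, scaled residuals diverge except at the null point
  \<open>y = a\<close>. This makes small scales infeasible.\<close>

lemma K_tendsto_1_scale: "(\<lambda>n. K a (1 / real (Suc n))) \<longlonglongrightarrow> 1"
proof -
  have "(\<lambda>n. K a (1 / real (Suc n))) \<longlonglongrightarrow> (LINT y|Fo. 1)"
    unfolding K_def
  proof (rule integral_dominated_convergence)
    have "AE y in lborel. y \<notin> {a}"
      by (rule finite_imp_AE_lborel) simp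
    then show "AE y in Fo. (\<lambda>n. \<rho> ((y - a) / (1 / real (Suc n)))) \<longlonglongrightarrow> 1"
      unfolding AE_Fo
    proof eventually_elim
      case (elim y)
      have "filterlim (\<lambda>n. \<bar>y - a\<bar> * real (Suc n)) at_top sequentially"
        using elim by (intro filterlim_tendsto_pos_mult_at_top[OF tendsto_const]
            filterlim_compose[OF filterlim_real_sequentially filterlim_Suc]) auto
      then show ?case
        by (intro rho_tendsto_1) (simp add: abs_mult)
    qed
    show "integrable Fo (\<lambda>_. 1 :: real)" by simp
  qed auto
  then show ?thesis by (simp add: Fo.prob_space)
qed

lemma K_tendsto_1_location:
  assumes "0 < s" "filterlim A at_top sequentially"
  shows "(\<lambda>n. K (A n) s) \<longlonglongrightarrow> 1"
proof -
  have "(\<lambda>n. K (A n) s) \<longlonglongrightarrow> (LINT y|Fo. 1)"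
    unfolding K_def
  proof (rule integral_dominated_convergence)
    show "AE y in Fo. (\<lambda>n. \<rho> ((y - A n) / s)) \<longlonglongrightarrow> 1"
    proof (rule AE_I2, rule rho_tendsto_1)
      fix y
      have "filterlim (\<lambda>n. - y + A n) at_top sequentially"
        by (rule filterlim_tendsto_add_at_top[OF tendsto_const assms(2)])
      then have "filterlim (\<lambda>n. (1 / s) * (- y + A n)) at_top sequentially"
        using assms(1) by (intro filterlim_tendsto_pos_mult_at_top[OF tendsto_const]) auto
      then show "filterlim (\<lambda>n. \<bar>(y - A n) / s\<bar>) at_top sequentially"
        by (rule filterlim_at_top_mono)
          (use assms(1) in \<open>auto simp: abs_divide intro!: divide_right_mono always_eventually\<close>)
    qed
    show "integrable Fo (\<lambda>_. 1 :: real)" by simp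
  qed auto
  then show ?thesis by (simp add: Fo.prob_space)
qed

text \<open>
  At \<open>k\<close> the loss passes the level \<open>\<rho> v\<close>, so the two losses differ for \<open>y\<close> between
  \<open>a + s * k\<close> and \<open>a + s' * k\<close>.
\<close>

lemma K_strict_antimono_scale:
  assumes v: "0 < v" "\<rho> v < 1" and s: "0 < s" "s < s'"
  shows "K a s' < K a s"
proof (rule ccontr)
  assume "\<not> ?thesis"
  then have eq: "K a s = K a s'"
    using K_antimono_scale[of s s' a] s by simp
  \<comment> \<open>The point where the loss passes the level \<open>\<rho> v\<close>: finite
    because \<open>\<rho> v < 1\<close>, and positive because it is at least
    \<open>v\<close>.\<close>
  define k where "k = Sup {u. \<rho> u \<le> \<rho> v}"
  have "\<forall>\<^sub>F u in at_top. \<rho> v < \<rho> u"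
    using order_tendstoD(1)[OF rho_lim v(2)] .
  then obtain B where B: "\<And>u. B \<le> u \<Longrightarrow> \<rho> v < \<rho> u"
    by (auto simp: eventually_at_top_linorder)
  then have bdd: "bdd_above {u. \<rho> u \<le> \<rho> v}"
    by (intro bdd_aboveI[of _ B]) (metis linorder_not_less mem_Collect_eq nle_le)
  have k: "v \<le> k"
    unfolding k_def by (rule cSup_upper[OF _ bdd]) simp
  have above: "\<rho> v < \<rho> u" if "k < u" for u
    using cSup_upper[OF _ bdd, of u] that unfolding k_def by force
  have below: "\<rho> u \<le> \<rho> v" if u: "0 \<le> u" "u < k" for u
  proof -
    obtain w where "\<rho> w \<le> \<rho> v" "u < w"
      using less_cSupD[of "{u. \<rho> u \<le> \<rho> v}" u] u unfolding k_def by auto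
    moreover have "\<rho> u \<le> \<rho> w"
      using \<open>u < w\<close> u by (intro rho_mono) auto
    ultimately show ?thesis by simp
  qed
  \<comment> \<open>Ordered functions with equal integrals agree almost everywhere, which an
    interval of positive length on which they differ will contradict.\<close>
  have "AE y in Fo. \<rho> ((y - a) / s) - \<rho> ((y - a) / s') = 0"
  proof (subst integral_nonneg_eq_0_iff_AE[symmetric])
    show "AE y in Fo. 0 \<le> \<rho> ((y - a) / s) - \<rho> ((y - a) / s')"
      using rho_antimono_scale[of s s'] s by auto
    show "integral\<^sup>L Fo (\<lambda>y. \<rho> ((y - a) / s) - \<rho> ((y - a) / s')) = 0"
      using eq by (simp add: rho_resid_integrable K_def)
  qed (intro Bochner_Integration.integrable_diff rho_resid_integrable)
  then have "AE y in lborel. \<rho> ((y - a) / s) = \<rho> ((y - a) / s')"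
    by (simp add: AE_Fo)
  then obtain N where N: "N \<in> null_sets lborel"
      "{y \<in> space lborel. \<rho> ((y - a) / s) \<noteq> \<rho> ((y - a) / s')} \<subseteq> N"
    by (rule AE_E3) auto
  have "{a + s * k<..<a + s' * k} \<subseteq> N"
  proof
    fix y assume y: "y \<in> {a + s * k<..<a + s' * k}"
    have "k < (y - a) / s" "(y - a) / s' < k"
      using y s by (auto simp: field_simps)
    moreover have "0 \<le> (y - a) / s'"
      using y s v k by (auto intro!: divide_nonneg_pos) (smt (verit) mult_nonneg_nonneg)
    ultimately have "\<rho> ((y - a) / s) \<noteq> \<rho> ((y - a) / s')"
      using above[of "(y - a) / s"] below[of "(y - a) / s'"] by simp
    then show "y \<in> N"
      using N(2) by auto
  qed
  then have "emeasure lborel {a + s * k<..<a + s' * k} \<le> emeasure lborel N"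
    using N(1) by (intro emeasure_mono) auto
  then have "emeasure lborel {a + s * k<..<a + s' * k} = 0"
    using N(1) by auto
  moreover have less: "a + s * k < a + s' * k"
    using s v k by (intro add_strict_left_mono mult_strict_right_mono) auto
  ultimately show False
    by (subst (asm) emeasure_lborel_Ioo[OF less_imp_le[OF less]]) (use less in \<open>simp only: ennreal_eq_0_iff\<close>)
qed

text \<open>The extreme loss that jumps from 0 to 1 at the origin. Its value 1 exceeds what the
  constraint allows, so this case can be excluded once a feasible scale exists.\<close>

lemma K_eq_1:
  assumes "\<And>v. 0 < v \<Longrightarrow> \<rho> v = 1" "0 < s"
  shows "K a s = 1"
proof -
  have "AE y in lborel. y \<notin> {a}"
    by (rule finite_imp_AE_lborel) simp
  then have "AE y in Fo. \<rho> ((y - a) / s) = 1"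
    unfolding AE_Fo
  proof eventually_elim
    case (elim y)
    then have "\<rho> \<bar>(y - a) / s\<bar> = 1"
      using assms by (intro assms(1)) auto
    then show ?case by (simp only: rho_abs)
  qed
  then have "K a s = (LINT y|Fo. 1)"
    unfolding K_def by (intro integral_cong_AE) auto
  then show ?thesis by (simp add: Fo.prob_space)
qed

end

section \<open>Integrals with respect to mixtures\<close>

text \<open>Induction from indicators through multiples and sums to monotone limits, where suprema
  of increasing sequences add up.\<close>

lemma nn_integral_mixture:
  assumes sets: "sets N = sets M" and f: "f \<in> borel_measurable M"
  shows "(\<integral>\<^sup>+x. f x \<partial>mixture \<epsilon> M N) = ennreal (1 - \<epsilon>) * (\<integral>\<^sup>+x. f x \<partial>M) + ennreal \<epsilon> * (\<integral>\<^sup>+x. f x \<partial>N)"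
  using f
proof (induct f rule: borel_measurable_induct)
  case (cong f g)
  moreover have "space N = space M"
    using sets by (rule sets_eq_imp_space_eq)
  ultimately show ?case
    using nn_integral_cong[of M f g] nn_integral_cong[of N f g] nn_integral_cong[of "mixture \<epsilon> M N" f g]
    by simp
next
  case (set A)
  then show ?case
    using sets by (simp add: emeasure_mixture)
next
  case (mult u a)
  have "u \<in> borel_measurable N" "u \<in> borel_measurable (mixture \<epsilon> M N)"
    using mult(2) sets by (simp_all cong: measurable_cong_sets)
  with mult show ?case
    by (simp add: nn_integral_cmult distrib_left mult.left_commute)
next
  case (add u v)
  have "u \<in> borel_measurable N" "u \<in> borel_measurable (mixture \<epsilon> M N)"
      "v \<in> borel_measurable N" "v \<in> borel_measurable (mixture \<epsilon> M N)"
    using add(1,4) sets by (simp_all cong: measurable_cong_sets)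
  with add show ?case
    by (simp add: nn_integral_add distrib_left ac_simps)
next
  case (seq U)
  have U: "U i \<in> borel_measurable N" "U i \<in> borel_measurable (mixture \<epsilon> M N)" for i
    using seq(1) sets by (simp_all cong: measurable_cong_sets)
  have inc: "incseq (\<lambda>i. a * integral\<^sup>N L (U i))" for a :: ennreal and L
    using \<open>incseq U\<close>
    by (auto simp: incseq_def intro!: mult_left_mono nn_integral_mono dest: le_funD)
  have "(SUP i. ennreal (1 - \<epsilon>) * integral\<^sup>N M (U i) + ennreal \<epsilon> * integral\<^sup>N N (U i))
      = ennreal (1 - \<epsilon>) * (SUP i. integral\<^sup>N M (U i)) + ennreal \<epsilon> * (SUP i. integral\<^sup>N N (U i))"
    by (simp add: ennreal_SUP_add[OF inc inc] SUP_mult_left_ennreal)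
  then show ?case
    using seq U by (simp add: nn_integral_monotone_convergence_SUP image_comp)
qed

lemma integral_mixture:
  fixes f :: "'a \<Rightarrow> real"
  assumes "prob_space M" "prob_space N" and sets: "sets N = sets M"
    and f [measurable]: "f \<in> borel_measurable M" and f01: "\<And>x. 0 \<le> f x" "\<And>x. f x \<le> 1"
    and \<epsilon>: "0 \<le> \<epsilon>" "\<epsilon> \<le> 1"
  shows "integral\<^sup>L (mixture \<epsilon> M N) f = (1 - \<epsilon>) * integral\<^sup>L M f + \<epsilon> * integral\<^sup>L N f"
proof -
  interpret M: prob_space M by fact
  interpret N: prob_space N by fact
  have [measurable]: "f \<in> borel_measurable N" "f \<in> borel_measurable (mixture \<epsilon> M N)"
    using f sets by (simp_all cong: measurable_cong_sets)
  have nn: "(\<integral>\<^sup>+x. ennreal (f x) \<partial>M) = ennreal (integral\<^sup>L M f)"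
      "(\<integral>\<^sup>+x. ennreal (f x) \<partial>N) = ennreal (integral\<^sup>L N f)"
    using f01 by (intro nn_integral_eq_integral M.integrable_const_bound[where B = 1]
        N.integrable_const_bound[where B = 1]; simp)+
  have nonneg: "0 \<le> integral\<^sup>L M f" "0 \<le> integral\<^sup>L N f"
    using f01 by auto
  have "integral\<^sup>L (mixture \<epsilon> M N) f = enn2real (\<integral>\<^sup>+x. ennreal (f x) \<partial>mixture \<epsilon> M N)"
    using f01 by (intro integral_eq_nn_integral) auto
  also have "\<dots> = enn2real (ennreal ((1 - \<epsilon>) * integral\<^sup>L M f + \<epsilon> * integral\<^sup>L N f))"
    using nonneg \<epsilon> by (simp add: nn_integral_mixture[OF sets] nn ennreal_plus ennreal_mult)
  also have "\<dots> = (1 - \<epsilon>) * integral\<^sup>L M f + \<epsilon> * integral\<^sup>L N f"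
    using nonneg \<epsilon> by (intro enn2real_ennreal) simp
  finally show ?thesis .
qed

lemma prob_space_mixture:
  assumes "prob_space M" "prob_space N" "sets N = sets M" "0 \<le> \<epsilon>" "\<epsilon> \<le> 1"
  shows "prob_space (mixture \<epsilon> M N)"
proof
  have "space N = space M"
    using assms(3) by (rule sets_eq_imp_space_eq)
  then have "emeasure N (space M) = 1"
    using prob_space.emeasure_space_1[OF assms(2)] by simp
  then show "emeasure (mixture \<epsilon> M N) (space (mixture \<epsilon> M N)) = 1"
    using assms(4,5) by (simp add: emeasure_mixture[OF assms(3)] prob_space.emeasure_space_1[OF assms(1)]
        flip: ennreal_plus)
qed

section \<open>Solutions of the CM-problem\<close>

text \<open>Treats both kinds of solution at once: a minimizer is its own witness \<open>w\<close>,
  and a limit minimizer is approached by feasible points of nearly optimal objective. Open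
  conditions on a solution thus pass to feasible points.\<close>

lemma CM_solution_approx:
  assumes z: "CM_solution \<rho> b c H z" and U: "open U" "z \<in> U"
    and w0: "w0 \<in> CM_feasible \<rho> b H" and v: "CM_objective \<rho> c H w0 < v"
  obtains w where "w \<in> U" "w \<in> CM_feasible \<rho> b H" "CM_objective \<rho> c H w < v"
proof (cases "\<exists>w. CM_minimizer \<rho> b c H w")
  case True
  then have "CM_minimizer \<rho> b c H z"
    using z by (simp add: CM_solution_def)
  then show ?thesis
    using that[of z] U w0 v by (force simp: CM_minimizer_def)
next
  case False
  then have "CM_limit_minimizer \<rho> b c H z"
    using z by (simp add: CM_solution_def)
  then obtain Z L where Z: "\<And>n. Z n \<in> CM_feasible \<rho> b H" "Z \<longlonglongrightarrow> z"
      "(\<lambda>n. CM_objective \<rho> c H (Z n)) \<longlonglongrightarrow> L" "L \<le> CM_objective \<rho> c H w0"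
    using w0 by (auto simp: CM_limit_minimizer_def)
  have "\<forall>\<^sub>F n in sequentially. Z n \<in> U \<and> CM_objective \<rho> c H (Z n) < v"
    using topological_tendstoD[OF Z(2) U] order_tendstoD(2)[OF Z(3), of v] Z(4) v
    by (auto intro: eventually_conj)
  then obtain n where "Z n \<in> U" "CM_objective \<rho> c H (Z n) < v"
    by (auto simp: eventually_sequentially)
  with Z(1) show ?thesis
    using that by blast
qed

section \<open>Mean losses of joint and of contaminated distributions\<close>

context bounded_loss
begin

lemma rho_resid_measurable:
  fixes H :: "(real \<times> (real ^ 'p)) measure"
  assumes "sets H = sets borel"
  shows "(\<lambda>(y, x). \<rho> ((y - \<alpha> - x \<bullet> \<theta>) / \<sigma>)) \<in> borel_measurable H"
proof -
  have "(\<lambda>p. (fst p - \<alpha> - snd p \<bullet> \<theta>) / \<sigma>) \<in> borel_measurable (borel :: (real \<times> (real ^ 'p)) measure)"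
    unfolding divide_inverse by (intro borel_measurable_continuous_onI continuous_intros)
  then have "(\<lambda>p. \<rho> ((fst p - \<alpha> - snd p \<bullet> \<theta>) / \<sigma>)) \<in> borel_measurable (borel :: (real \<times> (real ^ 'p)) measure)"
    by (rule measurable_compose[OF _ rho_measurable])
  then show ?thesis
    using assms by (simp add: case_prod_beta cong: measurable_cong_sets)
qed

lemma rho_resid_integrable_joint:
  fixes H :: "(real \<times> (real ^ 'p)) measure"
  assumes "prob_space H" "sets H = sets borel"
  shows "integrable H (\<lambda>(y, x). \<rho> ((y - \<alpha> - x \<bullet> \<theta>) / \<sigma>))"
proof -
  interpret prob_space H by fact
  show ?thesis
    by (rule integrable_const_bound[where B = 1]) (use rho_resid_measurable[OF assms(2)] in auto)
qed

lemma mean_loss_nonneg: "0 \<le> mean_loss \<rho> H z"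
  by (auto simp: mean_loss_def intro!: Bochner_Integration.integral_nonneg split: prod.splits)

lemma mean_loss_le_1:
  assumes "prob_space H" "sets H = sets borel"
  shows "mean_loss \<rho> H z \<le> 1"
proof -
  interpret prob_space H by fact
  obtain \<alpha> \<theta> \<sigma> where z: "z = (\<alpha>, \<theta>, \<sigma>)"
    by (cases z)
  show ?thesis
    unfolding mean_loss_def z prod.case
    by (rule integral_le_const[OF rho_resid_integrable_joint[OF assms]]) (auto intro: AE_I2)
qed

lemma mean_loss_mixture:
  assumes "prob_space M" "sets M = sets borel" "prob_space N" "sets N = sets borel" "0 \<le> \<epsilon>" "\<epsilon> \<le> 1"
  shows "mean_loss \<rho> (mixture \<epsilon> M N) z = (1 - \<epsilon>) * mean_loss \<rho> M z + \<epsilon> * mean_loss \<rho> N z"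
proof -
  obtain \<alpha> \<theta> \<sigma> where z: "z = (\<alpha>, \<theta>, \<sigma>)"
    by (cases z)
  show ?thesis
    unfolding mean_loss_def z prod.case
    by (rule integral_mixture) (use assms rho_resid_measurable[OF assms(2)] in auto)
qed

lemma rho_ext_measurable [measurable]: "rho_ext \<rho> \<in> borel_measurable borel"
  unfolding rho_ext_def by measurable

text \<open>The integral splits into the atom at \<open>e\<close> and the image of \<open>H\<close>
  under the absolute residual, where \<open>rho_ext\<close> reduces to \<open>\<rho>\<close> by
  symmetry.\<close>

lemma scale_loss_contaminated:
  fixes H :: "(real \<times> (real ^ 'p)) measure"
  assumes H: "prob_space H" "sets H = sets borel" and "0 \<le> \<epsilon>" "\<epsilon> \<le> 1" "0 < s"
  shows "scale_loss \<rho> (mixture \<epsilon> (abs_resid_dist H \<alpha> \<theta>) (return borel e)) s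
    = (1 - \<epsilon>) * mean_loss \<rho> H (\<alpha>, \<theta>, s) + \<epsilon> * rho_ext \<rho> (e / ennreal s)"
proof -
  interpret prob_space H by fact
  have "(\<lambda>p. \<bar>fst p - \<alpha> - snd p \<bullet> \<theta>\<bar>) \<in> borel_measurable (borel :: (real \<times> (real ^ 'p)) measure)"
    by (intro borel_measurable_continuous_onI continuous_intros)
  then have [measurable]: "(\<lambda>p. \<bar>fst p - \<alpha> - snd p \<bullet> \<theta>\<bar>) \<in> borel_measurable H"
    using H(2) by (simp cong: measurable_cong_sets)
  have [measurable]: "(\<lambda>(y, x). ennreal \<bar>y - \<alpha> - x \<bullet> \<theta>\<bar>) \<in> borel_measurable H"
    by (simp add: case_prod_beta)
  have P: "prob_space (abs_resid_dist H \<alpha> \<theta>)"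
    unfolding abs_resid_dist_def by (rule prob_space_distr) measurable
  have 01: "0 \<le> rho_ext \<rho> y" "rho_ext \<rho> y \<le> 1" for y
    by (auto simp: rho_ext_def)
  have [measurable]: "(\<lambda>y. rho_ext \<rho> (y / ennreal s)) \<in> borel_measurable borel"
    by measurable
  have "rho_ext \<rho> (ennreal \<bar>u\<bar> / ennreal s) = \<rho> (u / s)" for u
    using \<open>0 < s\<close> rho_abs[of "u / s"] by (simp add: rho_ext_def divide_ennreal abs_divide)
  then have "integral\<^sup>L (abs_resid_dist H \<alpha> \<theta>) (\<lambda>y. rho_ext \<rho> (y / ennreal s)) = mean_loss \<rho> H (\<alpha>, \<theta>, s)"
    unfolding abs_resid_dist_def mean_loss_def case_prod_beta
    by (subst integral_distr) (auto simp: case_prod_beta)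
  moreover have "integral\<^sup>L (return borel e) (\<lambda>y. rho_ext \<rho> (y / ennreal s)) = rho_ext \<rho> (e / ennreal s)"
    by (rule integral_return) auto
  moreover have "scale_loss \<rho> (mixture \<epsilon> (abs_resid_dist H \<alpha> \<theta>) (return borel e)) s
      = (1 - \<epsilon>) * integral\<^sup>L (abs_resid_dist H \<alpha> \<theta>) (\<lambda>y. rho_ext \<rho> (y / ennreal s))
        + \<epsilon> * integral\<^sup>L (return borel e) (\<lambda>y. rho_ext \<rho> (y / ennreal s))"
    unfolding scale_loss_def
    by (rule integral_mixture[OF P prob_space_return])
      (use assms 01 in \<open>auto simp: abs_resid_dist_def\<close>)
  ultimately show ?thesis
    by simp
qed

end

section \<open>The contaminated regression model\<close>

locale CM_model = unimodal_loss \<rho> Fo + Go: prob_space Go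
  for \<rho> :: "real \<Rightarrow> real" and Fo :: "real measure" and Go :: "(real ^ 'p::finite) measure" +
  fixes b c \<epsilon> :: real and Ho :: "(real \<times> (real ^ 'p)) measure"
  assumes sets_Go [simp, measurable_cong]: "sets Go = sets borel"
    and Ho_eq: "Ho = Fo \<Otimes>\<^sub>M Go"
    and c_pos: "0 < c" and eps_pos: "0 < \<epsilon>" and eps_less: "\<epsilon> < b" "\<epsilon> < 1 - b"
begin

abbreviation G :: "real \<Rightarrow> real ^ 'p \<Rightarrow> real \<Rightarrow> real" where
  "G \<alpha> \<theta> s \<equiv> mean_loss \<rho> Ho (\<alpha>, \<theta>, s)"

lemma eps_less_1: "\<epsilon> < 1" and b_less: "b < 1 - \<epsilon>"
  using eps_pos eps_less by auto

sublocale FG: pair_prob_space Fo Go ..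

lemma sets_Ho [simp]: "sets Ho = sets borel"
  unfolding Ho_eq by (simp add: borel_prod[symmetric] cong: sets_pair_measure_cong)

lemma prob_space_Ho: "prob_space Ho"
  unfolding Ho_eq by (rule FG.prob_space_axioms)

section \<open>The mean loss under \<open>Ho\<close> as an average of \<open>K\<close>\<close>

lemma K_resid_integrable: "integrable Go (\<lambda>x. K (\<alpha> + x \<bullet> \<theta>) s)"
  by (rule Go.integrable_const_bound[where B = 1]) (auto simp: K_nonneg K_le_1)

text \<open>Fubini, integrating over \<open>y\<close> first; monotonicity and limits of
  \<open>G\<close> are then inherited pointwise in \<open>x\<close> from \<open>K\<close>.\<close>

lemma G_eq: "G \<alpha> \<theta> s = (LINT x|Go. K (\<alpha> + x \<bullet> \<theta>) s)"
proof -
  have "G \<alpha> \<theta> s = integral\<^sup>L (Fo \<Otimes>\<^sub>M Go) (\<lambda>(y, x). \<rho> ((y - \<alpha> - x \<bullet> \<theta>) / s))"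
    by (simp add: mean_loss_def Ho_eq)
  also have "\<dots> = (LINT x|Go. LINT y|Fo. \<rho> ((y - \<alpha> - x \<bullet> \<theta>) / s))"
    using rho_resid_integrable_joint[OF prob_space_Ho sets_Ho]
    by (intro FG.integral_snd[symmetric]) (simp add: Ho_eq)
  finally show ?thesis
    by (simp add: K_def diff_diff_eq)
qed

lemma G_zero: "G 0 0 s = K 0 s"
  by (simp add: G_eq Go.prob_space)

lemma G_antimono_scale: "0 < s \<Longrightarrow> s \<le> s' \<Longrightarrow> G \<alpha> \<theta> s' \<le> G \<alpha> \<theta> s"
  unfolding G_eq by (intro integral_mono K_resid_integrable K_antimono_scale)

lemma K_0_le_G:
  assumes "0 < s"
  shows "K 0 s \<le> G \<alpha> \<theta> s"
proof -
  have "G 0 0 s \<le> G \<alpha> \<theta> s"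
    unfolding G_eq using assms by (intro integral_mono K_resid_integrable K_mono) auto
  then show ?thesis by (simp add: G_zero)
qed

text \<open>Scaling the coefficients by \<open>l\<close> scales the shift
  \<open>\<alpha> + x \<bullet> \<theta>\<close> by \<open>l\<close> for every \<open>x\<close>, and
  \<open>K\<close> grows with the size of the shift.\<close>

lemma G_shrink:
  assumes "0 \<le> l" "l \<le> 1" "0 < s"
  shows "G (l * \<alpha>) (l *\<^sub>R \<theta>) s \<le> G \<alpha> \<theta> s"
  unfolding G_eq
proof (intro integral_mono K_resid_integrable K_mono)
  fix x
  have "\<bar>l * \<alpha> + x \<bullet> l *\<^sub>R \<theta>\<bar> = l * \<bar>\<alpha> + x \<bullet> \<theta>\<bar>"
    using assms(1) by (simp add: abs_mult flip: distrib_left)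
  then show "\<bar>l * \<alpha> + x \<bullet> l *\<^sub>R \<theta>\<bar> \<le> \<bar>\<alpha> + x \<bullet> \<theta>\<bar>"
    using assms(1,2) by (simp add: mult_left_le_one_le)
qed (rule assms)

lemma G_tendsto_scale:
  assumes "S \<longlonglongrightarrow> s" "0 < s"
  shows "(\<lambda>n. G \<alpha> \<theta> (S n)) \<longlonglongrightarrow> G \<alpha> \<theta> s"
  unfolding G_eq
proof (rule integral_dominated_convergence)
  show "AE x in Go. (\<lambda>n. K (\<alpha> + x \<bullet> \<theta>) (S n)) \<longlonglongrightarrow> K (\<alpha> + x \<bullet> \<theta>) s"
    by (intro AE_I2 K_tendsto_scale assms)
  show "integrable Go (\<lambda>_. 1 :: real)" by simp
qed (auto simp: K_nonneg K_le_1)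

lemma G_continuous_scale: "continuous_on {0<..} (G \<alpha> \<theta>)"
  unfolding continuous_on_sequentially using G_tendsto_scale by (auto simp: o_def)

lemma G_strict_antimono_scale:
  assumes "0 < v" "\<rho> v < 1" "0 < s" "s < s'"
  shows "G \<alpha> \<theta> s' < G \<alpha> \<theta> s"
  unfolding G_eq
  by (rule Go.integral_less_AE_space[OF K_resid_integrable K_resid_integrable])
    (auto simp: K_strict_antimono_scale[OF assms] Go.emeasure_space_1)

section \<open>Uniform bounds on feasible scales and intercepts\<close>

lemma small_scale:
  assumes "\<eta> < 1"
  obtains s where "0 < s" "\<eta> < K 0 s"
proof -
  have "\<forall>\<^sub>F n in sequentially. \<eta> < K 0 (1 / real (Suc n))"
    by (rule order_tendstoD(1)[OF K_tendsto_1_scale assms])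
  then obtain n where "\<eta> < K 0 (1 / real (Suc n))"
    by (auto simp: eventually_sequentially)
  then show ?thesis
    by (intro that[of "1 / real (Suc n)"]) auto
qed

text \<open>\<open>K 0 s\<close> bounds the loss of every fit from below and exceeds
  \<open>b / (1 - \<epsilon>) < 1\<close> at small scales. Only the share of \<open>Ho\<close> in
  the constraint enters, so the bound serves all contaminations at once.\<close>

lemma scale_lower_bound:
  obtains \<sigma>\<^sub>0 where "0 < \<sigma>\<^sub>0" "\<And>\<alpha> \<theta> s. 0 < s \<Longrightarrow> (1 - \<epsilon>) * G \<alpha> \<theta> s \<le> b \<Longrightarrow> \<sigma>\<^sub>0 \<le> s"
proof -
  have "b / (1 - \<epsilon>) < 1"
    using b_less eps_less_1 by simp
  then obtain \<sigma>\<^sub>0 where s: "0 < \<sigma>\<^sub>0" "b / (1 - \<epsilon>) < K 0 \<sigma>\<^sub>0"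
    by (rule small_scale)
  have "\<sigma>\<^sub>0 \<le> s" if "0 < s" "(1 - \<epsilon>) * G \<alpha> \<theta> s \<le> b" for \<alpha> \<theta> s
  proof (rule ccontr)
    assume "\<not> ?thesis"
    then have "K 0 \<sigma>\<^sub>0 \<le> K 0 s"
      using that by (intro K_antimono_scale) auto
    also have "\<dots> \<le> G \<alpha> \<theta> s"
      by (rule K_0_le_G) fact
    also have "\<dots> \<le> b / (1 - \<epsilon>)"
      using that(2) eps_less_1 by (simp add: field_simps)
    finally show False using s(2) by simp
  qed
  with s(1) show ?thesis by (rule that)
qed

text \<open>With slope of norm at most \<open>M\<close>, an intercept of size above \<open>n\<close>
  leaves a shift of size at least \<open>n - M * norm x\<close>. Averaging over \<open>x\<close>,
  the loss tends to 1 and so passes \<open>b / (1 - \<epsilon>)\<close>.\<close>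

lemma intercept_bound:
  assumes "0 < S"
  obtains A where "\<And>\<alpha> \<theta> s. norm \<theta> \<le> M \<Longrightarrow> 0 < s \<Longrightarrow> s \<le> S \<Longrightarrow> (1 - \<epsilon>) * G \<alpha> \<theta> s \<le> b \<Longrightarrow> \<bar>\<alpha>\<bar> \<le> A"
proof -
  \<comment> \<open>Truncation at 0 is needed because \<open>K\<close> is monotone only in the
    absolute value of the shift.\<close>
  have "(\<lambda>n. LINT x|Go. K (max 0 (real n - M * norm x)) S) \<longlonglongrightarrow> (LINT x|Go. 1)"
  proof (rule integral_dominated_convergence)
    have "filterlim (\<lambda>n. max 0 (real n - M * norm x)) at_top sequentially" for x :: "real ^ 'p"
    proof (rule filterlim_at_top_mono)
      show "filterlim (\<lambda>n. - (M * norm x) + real n) at_top sequentially"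
        by (rule filterlim_tendsto_add_at_top[OF tendsto_const filterlim_real_sequentially])
    qed auto
    then show "AE x in Go. (\<lambda>n. K (max 0 (real n - M * norm x)) S) \<longlonglongrightarrow> 1"
      by (intro AE_I2 K_tendsto_1_location assms)
    show "integrable Go (\<lambda>_. 1 :: real)" by simp
  qed (auto simp: K_nonneg K_le_1)
  moreover have "b / (1 - \<epsilon>) < (LINT x|Go. 1)"
    using b_less eps_less_1 by (simp add: Go.prob_space)
  ultimately have "\<forall>\<^sub>F n in sequentially. b / (1 - \<epsilon>) < (LINT x|Go. K (max 0 (real n - M * norm x)) S)"
    by (rule order_tendstoD(1))
  then obtain n where n: "b / (1 - \<epsilon>) < (LINT x|Go. K (max 0 (real n - M * norm x)) S)"
    by (auto simp: eventually_sequentially)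
  have "\<bar>\<alpha>\<bar> \<le> real n" if "norm \<theta> \<le> M" "0 < s" "s \<le> S" "(1 - \<epsilon>) * G \<alpha> \<theta> s \<le> b" for \<alpha> \<theta> s
  proof (rule ccontr)
    assume \<alpha>: "\<not> ?thesis"
    have "(LINT x|Go. K (max 0 (real n - M * norm x)) S) \<le> G \<alpha> \<theta> S"
      unfolding G_eq
    proof (intro integral_mono K_resid_integrable K_mono)
      show "integrable Go (\<lambda>x. K (max 0 (real n - M * norm x)) S)"
        by (rule Go.integrable_const_bound[where B = 1]) (auto simp: K_nonneg K_le_1)
      fix x :: "real ^ 'p"
      have "\<bar>x \<bullet> \<theta>\<bar> \<le> norm x * norm \<theta>"
        by (rule Cauchy_Schwarz_ineq2)
      also have "\<dots> \<le> M * norm x"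
        using that(1) by (simp add: mult.commute mult_right_mono)
      finally show "\<bar>max 0 (real n - M * norm x)\<bar> \<le> \<bar>\<alpha> + x \<bullet> \<theta>\<bar>"
        using \<alpha> by linarith
    qed (rule assms)
    also have "\<dots> \<le> G \<alpha> \<theta> s"
      using that by (intro G_antimono_scale)
    also have "\<dots> \<le> b / (1 - \<epsilon>)"
      using that eps_less_1 by (simp add: field_simps)
    finally show False using n by simp
  qed
  then show ?thesis by (rule that)
qed

text \<open>The loss \<open>\<phi>\<close> is continuous and strictly decreasing once some scale is
  feasible. It then meets the level \<open>b\<close> exactly once, at the M-scale, and scales from
  there on are those with \<open>\<phi> s \<le> b\<close>.\<close>

lemma J_CM_contaminated:
  assumes e: "\<And>s. 0 < s \<Longrightarrow> rho_ext \<rho> (e / ennreal s) = w"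
  shows "J_CM \<rho> b c (mixture \<epsilon> (abs_resid_dist Ho \<alpha> \<theta>) (return borel e))
    = (INF s \<in> {s. 0 < s \<and> (1 - \<epsilon>) * G \<alpha> \<theta> s + \<epsilon> * w \<le> b}.
        ereal (c * ((1 - \<epsilon>) * G \<alpha> \<theta> s + \<epsilon> * w) + ln s))"
proof -
  define F where "F = mixture \<epsilon> (abs_resid_dist Ho \<alpha> \<theta>) (return borel e)"
  define \<phi> where "\<phi> s = (1 - \<epsilon>) * G \<alpha> \<theta> s + \<epsilon> * w" for s
  have loss: "scale_loss \<rho> F s = \<phi> s" if "0 < s" for s
    unfolding F_def \<phi>_def
    using scale_loss_contaminated[OF prob_space_Ho sets_Ho, of \<epsilon> s \<alpha> \<theta> e] e[OF that] that eps_pos eps_less_1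
    by simp
  have M: "is_M_scale \<rho> b F s \<longleftrightarrow> 0 < s \<and> \<phi> s = b" for s
    using loss by (auto simp: is_M_scale_def)
  have "w = rho_ext \<rho> (e / ennreal 1)"
    using e[of 1] by simp
  then have w: "0 \<le> w"
    by (simp add: rho_ext_def)
  have "J_CM \<rho> b c F = (INF s \<in> {s. 0 < s \<and> \<phi> s \<le> b}. ereal (c * \<phi> s + ln s))"
  proof (cases "{s. 0 < s \<and> \<phi> s \<le> b} = {}")
    \<comment> \<open>With no admissible scale there is no M-scale, and the empty infimum equals the
      default value \<open>\<infinity>\<close> of \<open>J_CM\<close>.\<close>
    case True
    then have "\<nexists>s. is_M_scale \<rho> b F s"
      using M by fastforce
    then have "\<not> (\<exists>!s. is_M_scale \<rho> b F s)"
      by blast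
    then show ?thesis
      by (simp add: J_CM_def True top_ereal_def)
  next
    case False
    then obtain s1 where s1: "0 < s1" "\<phi> s1 \<le> b"
      by blast
    have mono: "\<phi> s' \<le> \<phi> s" if "0 < s" "s \<le> s'" for s s'
      unfolding \<phi>_def using G_antimono_scale[OF that] eps_less_1 by (intro add_right_mono mult_left_mono) auto
    \<comment> \<open>Otherwise \<open>\<phi> s1\<close> would be at least
      \<open>1 - \<epsilon>\<close>, which exceeds \<open>b\<close>.\<close>
    have "\<exists>v>0. \<rho> v < 1"
    proof (rule ccontr)
      assume "\<not> ?thesis"
      then have "\<rho> v = 1" if "0 < v" for v
        using rho_le_1[of v] that by (meson linorder_not_less order_antisym)
      then have "G \<alpha> \<theta> s1 = 1"
        using s1(1) by (simp add: G_eq K_eq_1 Go.prob_space)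
      then show False
        using s1(2) w eps_pos b_less unfolding \<phi>_def by (smt (verit) mult_nonneg_nonneg mult_cancel_left2)
    qed
    then obtain v where v: "0 < v" "\<rho> v < 1" by blast
    have strict: "\<phi> s' < \<phi> s" if "0 < s" "s < s'" for s s'
      unfolding \<phi>_def using G_strict_antimono_scale[OF v that] eps_less_1 by simp
    \<comment> \<open>A scale \<open>s0\<close> with loss above \<open>b\<close> is sought; with the
      feasible \<open>s1\<close> it brackets the M-scale for the intermediate value theorem.\<close>
    have "b / (1 - \<epsilon>) < 1"
      using b_less eps_less_1 by simp
    then obtain s0 where s0: "0 < s0" "b / (1 - \<epsilon>) < K 0 s0"
      by (rule small_scale)
    have "b < (1 - \<epsilon>) * K 0 s0"
      using s0(2) eps_less_1 by (simp add: field_simps)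
    also have "\<dots> \<le> (1 - \<epsilon>) * G \<alpha> \<theta> s0"
      using K_0_le_G[OF s0(1)] eps_less_1 by (intro mult_left_mono) auto
    finally have s0': "b < \<phi> s0"
      unfolding \<phi>_def using w eps_pos by (smt (verit) mult_nonneg_nonneg)
    have "s0 \<le> s1"
      using mono[OF s1(1), of s0] s0' s1(2) by force
    have "continuous_on {s0..s1} \<phi>"
      unfolding \<phi>_def using s0(1)
      by (intro continuous_intros continuous_on_subset[OF G_continuous_scale]) auto
    then obtain \<sigma> where "s0 \<le> \<sigma>" and \<phi>_\<sigma>: "\<phi> \<sigma> = b"
      using IVT2'[of \<phi> s1 b s0] s0' s1(2) \<open>s0 \<le> s1\<close> by auto
    then have \<sigma>: "0 < \<sigma>" "\<phi> \<sigma> = b"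
      using s0(1) by auto
    have unique: "s = \<sigma>" if "0 < s" "\<phi> s = b" for s
      using strict[of s \<sigma>] strict[of \<sigma> s] that \<sigma> by (cases s \<sigma> rule: linorder_cases) auto
    have ex1: "\<exists>!s. is_M_scale \<rho> b F s"
      unfolding M using \<sigma> unique by blast
    have "M_scale \<rho> b F = \<sigma>"
      unfolding M_scale_def M by (rule the_equality) (simp_all add: \<sigma> unique)
    moreover have "{s. 0 < s \<and> \<phi> s \<le> b} = {\<sigma>..}"
    proof (intro equalityI subsetI)
      fix s assume "s \<in> {s. 0 < s \<and> \<phi> s \<le> b}"
      then show "s \<in> {\<sigma>..}"
        using strict[of s \<sigma>] \<phi>_\<sigma> by (cases "s < \<sigma>") auto
    next
      fix s assume "s \<in> {\<sigma>..}"
      then show "s \<in> {s. 0 < s \<and> \<phi> s \<le> b}"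
        using mono[of \<sigma> s] \<sigma> by auto
    qed
    ultimately show ?thesis
      unfolding J_CM_def using ex1 \<sigma>(1) by (simp add: loss cong: INF_cong_simp)
  qed
  then show ?thesis
    by (simp add: F_def \<phi>_def)
qed

lemma r_CM_eq:
  "r_CM \<rho> b c Ho \<epsilon> = (INF s \<in> {s. 0 < s \<and> (1 - \<epsilon>) * K 0 s + \<epsilon> \<le> b}.
      ereal (c * ((1 - \<epsilon>) * K 0 s + \<epsilon>) + ln s))"
proof -
  have "rho_ext \<rho> (\<infinity> / ennreal s) = 1" if "0 < s" for s
    by (simp add: rho_ext_def ennreal_top_divide)
  then show ?thesis
    unfolding r_CM_def by (subst J_CM_contaminated[where w = 1]) (simp_all add: G_zero)
qed

lemma m_CM_eq:
  "m_CM \<rho> b c Ho \<epsilon> t = (INF \<theta> \<in> {\<theta>. norm \<theta> = t}. INF \<alpha>.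
      INF s \<in> {s. 0 < s \<and> (1 - \<epsilon>) * G \<alpha> \<theta> s \<le> b}. ereal (c * ((1 - \<epsilon>) * G \<alpha> \<theta> s) + ln s))"
proof -
  have "rho_ext \<rho> (0 / ennreal s) = 0" for s
    by (simp add: rho_ext_def)
  then show ?thesis
    unfolding m_CM_def by (subst J_CM_contaminated[where w = 0]) simp_all
qed

end

context CM_model
begin

section \<open>The bias bounds\<close>

lemma m_CM_le:
  assumes "0 < s" "(1 - \<epsilon>) * G \<alpha> \<theta> s \<le> b"
  shows "m_CM \<rho> b c Ho \<epsilon> (norm \<theta>) \<le> ereal (c * ((1 - \<epsilon>) * G \<alpha> \<theta> s) + ln s)"
  unfolding m_CM_eq
  by (rule INF_lower2[of \<theta>], simp, rule INF_lower2[of \<alpha>], simp, rule INF_lower) (use assms in simp)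

text \<open>Contracting a fit from slope norm \<open>t'\<close> to \<open>t\<close> at the same
  scale lowers its loss, hence keeps it feasible and does not raise the objective.\<close>

lemma m_CM_mono:
  assumes "0 \<le> t" "t \<le> t'"
  shows "m_CM \<rho> b c Ho \<epsilon> t \<le> m_CM \<rho> b c Ho \<epsilon> t'"
proof (cases "t = t'")
  case False
  \<comment> \<open>Here \<open>t < t'\<close>, so the division is by a positive number.\<close>
  define l where "l = t / t'"
  have l: "0 \<le> l" "l \<le> 1" "l * t' = t"
    using assms False by (auto simp: l_def)
  show ?thesis
    unfolding m_CM_eq[of t']
  proof (intro INF_greatest)
    fix \<theta> :: "real ^ 'p" and \<alpha> s
    assume \<theta>: "\<theta> \<in> {\<theta>. norm \<theta> = t'}" and "s \<in> {s. 0 < s \<and> (1 - \<epsilon>) * G \<alpha> \<theta> s \<le> b}"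
    then have s: "0 < s" "(1 - \<epsilon>) * G \<alpha> \<theta> s \<le> b"
      by auto
    have le: "(1 - \<epsilon>) * G (l * \<alpha>) (l *\<^sub>R \<theta>) s \<le> (1 - \<epsilon>) * G \<alpha> \<theta> s"
      using eps_less_1 by (intro mult_left_mono G_shrink l s) auto
    have "m_CM \<rho> b c Ho \<epsilon> t \<le> ereal (c * ((1 - \<epsilon>) * G (l * \<alpha>) (l *\<^sub>R \<theta>) s) + ln s)"
      using m_CM_le[of s "l * \<alpha>" "l *\<^sub>R \<theta>"] le s l \<theta> by simp
    also have "\<dots> \<le> ereal (c * ((1 - \<epsilon>) * G \<alpha> \<theta> s) + ln s)"
      using mult_left_mono[OF le less_imp_le[OF c_pos]] by simp
    finally show "m_CM \<rho> b c Ho \<epsilon> t \<le> ereal (c * ((1 - \<epsilon>) * G \<alpha> \<theta> s) + ln s)" .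
  qed
qed simp

lemma m_CM_lessE:
  assumes "m_CM \<rho> b c Ho \<epsilon> t < v"
  obtains \<alpha> \<theta> s where "norm \<theta> = t" "0 < s" "(1 - \<epsilon>) * G \<alpha> \<theta> s \<le> b"
    "ereal (c * ((1 - \<epsilon>) * G \<alpha> \<theta> s) + ln s) < v"
  using assms unfolding m_CM_eq INF_less_iff by auto

section \<open>Upper bound: existence and size of solutions under arbitrary contamination\<close>

context
  fixes Hs :: "(real \<times> (real ^ 'p)) measure"
  assumes Hs: "prob_space Hs" "sets Hs = sets borel"
begin

lemma mean_loss_contaminated:
  "mean_loss \<rho> (mixture \<epsilon> Ho Hs) z = (1 - \<epsilon>) * mean_loss \<rho> Ho z + \<epsilon> * mean_loss \<rho> Hs z"
  using mean_loss_mixture[OF prob_space_Ho sets_Ho Hs] eps_pos eps_less_1 by simp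

text \<open>Dropping the nonnegative loss of the contamination gives the situation of
  \<open>m_CM\<close>; dropping the loss of \<open>Ho\<close> as well leaves a bound on the
  scale.\<close>

lemma feasible_contaminatedD:
  assumes "(\<alpha>, \<theta>, s) \<in> CM_feasible \<rho> b (mixture \<epsilon> Ho Hs)"
  shows "0 < s" "(1 - \<epsilon>) * G \<alpha> \<theta> s \<le> b"
    "c * ((1 - \<epsilon>) * G \<alpha> \<theta> s) + ln s \<le> CM_objective \<rho> c (mixture \<epsilon> Ho Hs) (\<alpha>, \<theta>, s)"
    "ln s \<le> CM_objective \<rho> c (mixture \<epsilon> Ho Hs) (\<alpha>, \<theta>, s)"
proof -
  have *: "0 \<le> \<epsilon> * mean_loss \<rho> Hs (\<alpha>, \<theta>, s)" "0 \<le> (1 - \<epsilon>) * G \<alpha> \<theta> s"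
    using eps_pos eps_less_1 by (auto simp: mean_loss_nonneg)
  then have "0 \<le> c * (\<epsilon> * mean_loss \<rho> Hs (\<alpha>, \<theta>, s))" "0 \<le> c * ((1 - \<epsilon>) * G \<alpha> \<theta> s)"
    using c_pos by auto
  with * assms show "0 < s" "(1 - \<epsilon>) * G \<alpha> \<theta> s \<le> b"
    "c * ((1 - \<epsilon>) * G \<alpha> \<theta> s) + ln s \<le> CM_objective \<rho> c (mixture \<epsilon> Ho Hs) (\<alpha>, \<theta>, s)"
    "ln s \<le> CM_objective \<rho> c (mixture \<epsilon> Ho Hs) (\<alpha>, \<theta>, s)"
    by (auto simp: CM_feasible_def CM_objective_def mean_loss_contaminated distrib_left)
qed

text \<open>The competitor is \<open>(0, 0, s)\<close>: \<open>r_CM\<close> charges the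
  contamination the full loss 1, and no \<open>Hs\<close> can cost more.\<close>

lemma r_CM_lessE:
  assumes "r_CM \<rho> b c Ho \<epsilon> < ereal v"
  obtains w where "w \<in> CM_feasible \<rho> b (mixture \<epsilon> Ho Hs)" "CM_objective \<rho> c (mixture \<epsilon> Ho Hs) w < v"
proof -
  obtain s where s: "0 < s" "(1 - \<epsilon>) * K 0 s + \<epsilon> \<le> b" "c * ((1 - \<epsilon>) * K 0 s + \<epsilon>) + ln s < v"
    using assms unfolding r_CM_eq INF_less_iff by auto
  have le: "mean_loss \<rho> (mixture \<epsilon> Ho Hs) (0, 0, s) \<le> (1 - \<epsilon>) * K 0 s + \<epsilon>"
    using mean_loss_le_1[OF Hs] eps_pos by (simp add: mean_loss_contaminated G_zero mult_left_le)
  then have "c * mean_loss \<rho> (mixture \<epsilon> Ho Hs) (0, 0, s) \<le> c * ((1 - \<epsilon>) * K 0 s + \<epsilon>)"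
    using c_pos by (intro mult_left_mono) auto
  with le s show ?thesis
    by (intro that[of "(0, 0, s)"]) (auto simp: CM_feasible_def CM_objective_def)
qed

lemma small_objective_imp_slope_le:
  assumes "0 \<le> t" "ereal v < m_CM \<rho> b c Ho \<epsilon> t"
    and w: "(\<alpha>, \<theta>, s) \<in> CM_feasible \<rho> b (mixture \<epsilon> Ho Hs)"
      "CM_objective \<rho> c (mixture \<epsilon> Ho Hs) (\<alpha>, \<theta>, s) < v"
  shows "norm \<theta> \<le> t"
proof (rule ccontr)
  assume "\<not> ?thesis"
  then have "m_CM \<rho> b c Ho \<epsilon> t \<le> m_CM \<rho> b c Ho \<epsilon> (norm \<theta>)"
    using assms(1) by (intro m_CM_mono) auto
  also have "\<dots> \<le> ereal (c * ((1 - \<epsilon>) * G \<alpha> \<theta> s) + ln s)"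
    by (intro m_CM_le feasible_contaminatedD(1,2)[OF w(1)])
  also have "\<dots> \<le> ereal v"
    using feasible_contaminatedD(3)[OF w(1)] w(2) by simp
  finally show False using assms(2) by simp
qed

text \<open>Take a level \<open>v\<close> strictly between the two values. A slope longer than
  \<open>t\<close> is an open condition, so it would be shared by a feasible point with objective
  below \<open>v\<close>, which costs at least \<open>m_CM\<close> at \<open>t\<close>.\<close>

lemma solution_slope_le:
  assumes t: "0 \<le> t" "r_CM \<rho> b c Ho \<epsilon> < m_CM \<rho> b c Ho \<epsilon> t"
    and z: "CM_solution \<rho> b c (mixture \<epsilon> Ho Hs) (\<alpha>, \<theta>, s)"
  shows "norm \<theta> \<le> t"
proof (rule ccontr)
  assume not_le: "\<not> ?thesis"
  obtain v where v: "r_CM \<rho> b c Ho \<epsilon> < ereal v" "ereal v < m_CM \<rho> b c Ho \<epsilon> t"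
    using ereal_dense2[OF t(2)] by auto
  obtain w0 where w0: "w0 \<in> CM_feasible \<rho> b (mixture \<epsilon> Ho Hs)"
      "CM_objective \<rho> c (mixture \<epsilon> Ho Hs) w0 < v"
    using v(1) by (rule r_CM_lessE)
  have op: "open {w :: real \<times> (real ^ 'p) \<times> real. t < norm (fst (snd w))}"
    by (intro open_Collect_less continuous_intros)
  obtain w where "t < norm (fst (snd w))" "w \<in> CM_feasible \<rho> b (mixture \<epsilon> Ho Hs)"
      "CM_objective \<rho> c (mixture \<epsilon> Ho Hs) w < v"
    by (rule CM_solution_approx[OF z op _ w0]) (use not_le in auto)
  then show False
    using small_objective_imp_slope_le[OF t(1) v(2)] by (cases w) force
qed

text \<open>Feasible points with objective below a level \<open>v\<close> between the two values
  form part of a compact set: \<open>m_CM\<close> bounds the slope, the constraint bounds the scale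
  below and then the intercept, and \<open>ln s < v\<close> bounds the scale above. A minimizing
  sequence therefore has a limit point of positive scale.\<close>

lemma solution_exists:
  assumes t: "0 \<le> t" "r_CM \<rho> b c Ho \<epsilon> < m_CM \<rho> b c Ho \<epsilon> t"
  shows "\<exists>z. CM_solution \<rho> b c (mixture \<epsilon> Ho Hs) z"
proof -
  let ?F = "CM_feasible \<rho> b (mixture \<epsilon> Ho Hs)" and ?obj = "CM_objective \<rho> c (mixture \<epsilon> Ho Hs)"
  obtain v where v: "r_CM \<rho> b c Ho \<epsilon> < ereal v" "ereal v < m_CM \<rho> b c Ho \<epsilon> t"
    using ereal_dense2[OF t(2)] by auto
  obtain w0 where w0: "w0 \<in> ?F" "?obj w0 < v"
    using v(1) by (rule r_CM_lessE)
  obtain \<sigma>\<^sub>0 where \<sigma>\<^sub>0: "0 < \<sigma>\<^sub>0" "\<And>\<alpha> \<theta> s. 0 < s \<Longrightarrow> (1 - \<epsilon>) * G \<alpha> \<theta> s \<le> b \<Longrightarrow> \<sigma>\<^sub>0 \<le> s"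
    using scale_lower_bound by blast
  obtain A where A: "\<And>\<alpha> \<theta> s. norm \<theta> \<le> t \<Longrightarrow> 0 < s \<Longrightarrow> s \<le> exp v \<Longrightarrow> (1 - \<epsilon>) * G \<alpha> \<theta> s \<le> b \<Longrightarrow> \<bar>\<alpha>\<bar> \<le> A"
    using intercept_bound[of "exp v" t] by auto
  define S where "S = {- A..A} \<times> cball (0 :: real ^ 'p) t \<times> {\<sigma>\<^sub>0..exp v}"
  have S: "compact S"
    unfolding S_def by (intro compact_Times compact_Icc compact_cball)
  have in_S: "w \<in> S" if "w \<in> ?F" "?obj w < v" for w
  proof -
    obtain \<alpha> \<theta> s where w: "w = (\<alpha>, \<theta>, s)"
      by (cases w)
    note D = feasible_contaminatedD[OF that(1)[unfolded w]]
    have \<theta>: "norm \<theta> \<le> t"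
      using small_objective_imp_slope_le[OF t(1) v(2)] that unfolding w by blast
    have "ln s < v"
      using D(4) that(2) unfolding w by simp
    then have s: "s \<le> exp v"
      using D(1) by (metis exp_less_mono exp_ln less_imp_le)
    show ?thesis
      using A[OF \<theta> D(1) s D(2)] \<sigma>\<^sub>0(2)[OF D(1,2)] \<theta> s by (auto simp: S_def w)
  qed
  define I where "I = Inf (?obj ` ?F)"
  have "ln \<sigma>\<^sub>0 \<le> ?obj w" if "w \<in> ?F" for w
  proof -
    obtain \<alpha> \<theta> s where w: "w = (\<alpha>, \<theta>, s)"
      by (cases w)
    note D = feasible_contaminatedD[OF that[unfolded w]]
    have "ln \<sigma>\<^sub>0 \<le> ln s"
      using \<sigma>\<^sub>0 D(1,2) by simp
    with D(4) show ?thesis by (simp add: w)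
  qed
  then have bdd: "bdd_below (?obj ` ?F)"
    by (rule bdd_belowI2)
  have I: "I \<le> ?obj w" if "w \<in> ?F" for w
    unfolding I_def by (intro cInf_lower imageI that bdd)
  have "I < v"
    using I[OF w0(1)] w0(2) by simp
  \<comment> \<open>The slack tends to 0 and never exceeds \<open>v - I\<close>, which keeps the
    whole sequence below level \<open>v\<close> and so in \<open>S\<close>.\<close>
  have "\<exists>w. w \<in> ?F \<and> ?obj w < I + (v - I) / real (Suc n)" for n
  proof -
    have "Inf (?obj ` ?F) < I + (v - I) / real (Suc n)"
      using \<open>I < v\<close> by (simp add: I_def)
    then obtain y where "y \<in> ?obj ` ?F" "y < I + (v - I) / real (Suc n)"
      using cInf_lessD[of "?obj ` ?F"] w0(1) by blast
    then show ?thesis by blast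
  qed
  then obtain Z where Z: "\<And>n. Z n \<in> ?F" "\<And>n. ?obj (Z n) < I + (v - I) / real (Suc n)"
    by metis
  have "Z n \<in> S" for n
  proof (rule in_S)
    have "(v - I) / real (Suc n) \<le> (v - I) / 1"
      using \<open>I < v\<close> by (intro divide_left_mono) auto
    then show "?obj (Z n) < v"
      using Z(2)[of n] by simp
  qed (rule Z)
  then obtain z r where z: "z \<in> S" "strict_mono r" "(Z \<circ> r) \<longlonglongrightarrow> z"
    using S unfolding compact_eq_seq_compact_metric by (blast elim: seq_compactE)
  have "(\<lambda>n. ?obj (Z n)) \<longlonglongrightarrow> I"
  proof (rule tendsto_sandwich)
    show "\<forall>\<^sub>F n in sequentially. I \<le> ?obj (Z n)"
      using I Z(1) by auto
    show "\<forall>\<^sub>F n in sequentially. ?obj (Z n) \<le> I + (v - I) / real (Suc n)"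
      by (intro always_eventually allI less_imp_le Z(2))
    have "(\<lambda>n. I + (v - I) / real (Suc n)) \<longlonglongrightarrow> I + 0"
      by (intro tendsto_add tendsto_const LIMSEQ_Suc[OF lim_const_over_n])
    then show "(\<lambda>n. I + (v - I) / real (Suc n)) \<longlonglongrightarrow> I"
      by simp
  qed simp
  then have "(\<lambda>n. ?obj ((Z \<circ> r) n)) \<longlonglongrightarrow> I"
    using LIMSEQ_subseq_LIMSEQ[OF _ z(2)] by (fastforce simp: o_def)
  moreover have "0 < snd (snd z)"
    using z(1) \<sigma>\<^sub>0(1) by (auto simp: S_def)
  ultimately have "CM_limit_minimizer \<rho> b c (mixture \<epsilon> Ho Hs) z"
    unfolding CM_limit_minimizer_def using Z(1) z(3) I
    by (intro conjI exI[of _ "Z \<circ> r"] exI[of _ I]) auto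
  \<comment> \<open>If a minimizer exists, it is a solution; if not, the limit \<open>z\<close> is
    one.\<close>
  then show ?thesis
    unfolding CM_solution_def by meson
qed

end

section \<open>Lower bound: a contamination that forces a long slope\<close>

text \<open>
  A finite point mass has loss close to 1 but not necessarily equal to 1, unlike the mass at
  infinity in \<^const>\<open>r_CM\<close>, hence the slack \<open>\<eta>\<close>.
\<close>

lemma r_CM_stable:
  assumes v: "ereal v < r_CM \<rho> b c Ho \<epsilon>"
  obtains \<eta> where "0 < \<eta>" "\<eta> \<le> 1" "\<And>s. 0 < s \<Longrightarrow> (1 - \<epsilon>) * K 0 s + \<epsilon> * (1 - \<eta>) \<le> b \<Longrightarrow>
      v \<le> c * ((1 - \<epsilon>) * K 0 s + \<epsilon> * (1 - \<eta>)) + ln s"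
proof -
  let ?L = "\<lambda>\<eta> s. (1 - \<epsilon>) * K 0 s + \<epsilon> * (1 - \<eta>)"
  define e where "e n = 1 / real (Suc n)" for n
  have "\<exists>n. \<forall>s>0. ?L (e n) s \<le> b \<longrightarrow> v \<le> c * ?L (e n) s + ln s"
  proof (rule ccontr)
    assume "\<not> ?thesis"
    \<comment> \<open>Scales violating the claim for slacks \<open>e n\<close> tending to 0 stay in
      a compact interval away from 0. A limit point is admissible in \<open>r_CM\<close> with value
      at most \<open>v\<close>, contradicting the choice of \<open>v\<close>.\<close>
    then obtain S where S: "\<And>n. 0 < S n" "\<And>n. ?L (e n) (S n) \<le> b" "\<And>n. c * ?L (e n) (S n) + ln (S n) < v"
      by (metis not_le)
    obtain \<sigma>\<^sub>0 where \<sigma>\<^sub>0: "0 < \<sigma>\<^sub>0" "\<And>\<alpha> \<theta> s. 0 < s \<Longrightarrow> (1 - \<epsilon>) * G \<alpha> \<theta> s \<le> b \<Longrightarrow> \<sigma>\<^sub>0 \<le> s"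
      using scale_lower_bound by blast
    have "S n \<in> {\<sigma>\<^sub>0..exp v}" for n
    proof -
      have nonneg: "0 \<le> \<epsilon> * (1 - e n)"
        using eps_pos by (simp add: e_def)
      then have "(1 - \<epsilon>) * G 0 0 (S n) \<le> b"
        using S(2)[of n] by (simp add: G_zero)
      then have lower: "\<sigma>\<^sub>0 \<le> S n"
        by (rule \<sigma>\<^sub>0(2)[OF S(1)])
      have "0 \<le> c * ?L (e n) (S n)"
        using nonneg c_pos eps_less_1 by (simp add: K_nonneg)
      then have "ln (S n) < v"
        using S(3)[of n] by simp
      then show ?thesis
        using S(1)[of n] lower by (simp add: ln_less_cancel_iff) (metis exp_less_mono exp_ln less_imp_le)
    qed
    moreover have "seq_compact {\<sigma>\<^sub>0..exp v}"
      by (rule compact_imp_seq_compact) (rule compact_Icc)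
    ultimately obtain s r where s: "s \<in> {\<sigma>\<^sub>0..exp v}" "strict_mono r" "(S \<circ> r) \<longlonglongrightarrow> s"
      by (blast elim: seq_compactE)
    have "0 < s"
      using s(1) \<sigma>\<^sub>0(1) by auto
    have "e \<longlonglongrightarrow> 0"
      unfolding e_def by (rule LIMSEQ_Suc[OF lim_const_over_n])
    then have "(e \<circ> r) \<longlonglongrightarrow> 0"
      by (rule LIMSEQ_subseq_LIMSEQ[OF _ s(2)])
    then have L: "(\<lambda>n. ?L ((e \<circ> r) n) ((S \<circ> r) n)) \<longlonglongrightarrow> ?L 0 s"
      by (intro tendsto_intros K_tendsto_scale[OF s(3) \<open>0 < s\<close>])
    have "?L 0 s \<le> b"
      by (rule LIMSEQ_le_const2[OF L]) (use S(2) in auto)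
    then have "r_CM \<rho> b c Ho \<epsilon> \<le> ereal (c * ((1 - \<epsilon>) * K 0 s + \<epsilon>) + ln s)"
      unfolding r_CM_eq using \<open>0 < s\<close> by (intro INF_lower) auto
    moreover have "(\<lambda>n. c * ?L ((e \<circ> r) n) ((S \<circ> r) n) + ln ((S \<circ> r) n)) \<longlonglongrightarrow> c * ?L 0 s + ln s"
      using \<open>0 < s\<close> by (intro tendsto_intros L s(3)) auto
    then have "c * ?L 0 s + ln s \<le> v"
      by (rule LIMSEQ_le_const2) (use S(3) in \<open>auto intro: less_imp_le\<close>)
    then have "ereal (c * ((1 - \<epsilon>) * K 0 s + \<epsilon>) + ln s) \<le> ereal v"
      by simp
    ultimately have "r_CM \<rho> b c Ho \<epsilon> \<le> ereal v"
      by (rule order_trans)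
    with v show False by simp
  qed
  then obtain n where "\<And>s. 0 < s \<Longrightarrow> ?L (e n) s \<le> b \<Longrightarrow> v \<le> c * ?L (e n) s + ln s"
    by blast
  then show ?thesis
    by (intro that[of "e n"]) (auto simp: e_def)
qed

text \<open>
  The contamination is a point mass on the hyperplane \<open>y = \<alpha> + x \<bullet> \<theta>\<close>, at a leverage \<open>x\<close> so
  large that every competitor with a shorter slope has loss close to 1 there.
\<close>

lemma least_favourable_contamination:
  assumes t: "0 \<le> u" "u < t" "m_CM \<rho> b c Ho \<epsilon> t < r_CM \<rho> b c Ho \<epsilon>"
  obtains Hs where "prob_space Hs" "sets Hs = sets borel"
    "\<And>\<alpha> \<theta> s. CM_solution \<rho> b c (mixture \<epsilon> Ho Hs) (\<alpha>, \<theta>, s) \<Longrightarrow> u \<le> norm \<theta>"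
proof -
  obtain v where v: "m_CM \<rho> b c Ho \<epsilon> t < ereal v" "ereal v < r_CM \<rho> b c Ho \<epsilon>"
    using ereal_dense2[OF t(3)] by auto
  obtain \<alpha>\<^sub>1 \<theta>\<^sub>1 s\<^sub>1 where 1: "norm \<theta>\<^sub>1 = t" "0 < s\<^sub>1" "(1 - \<epsilon>) * G \<alpha>\<^sub>1 \<theta>\<^sub>1 s\<^sub>1 \<le> b"
      "c * ((1 - \<epsilon>) * G \<alpha>\<^sub>1 \<theta>\<^sub>1 s\<^sub>1) + ln s\<^sub>1 < v"
    using v(1) by (rule m_CM_lessE) auto
  obtain \<eta> where \<eta>: "0 < \<eta>" "\<eta> \<le> 1" "\<And>s. 0 < s \<Longrightarrow> (1 - \<epsilon>) * K 0 s + \<epsilon> * (1 - \<eta>) \<le> b \<Longrightarrow>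
      v \<le> c * ((1 - \<epsilon>) * K 0 s + \<epsilon> * (1 - \<eta>)) + ln s"
    using v(2) by (rule r_CM_stable) blast
  obtain A where A: "\<And>\<alpha> \<theta> s. norm \<theta> \<le> u \<Longrightarrow> 0 < s \<Longrightarrow> s \<le> exp v \<Longrightarrow> (1 - \<epsilon>) * G \<alpha> \<theta> s \<le> b \<Longrightarrow> \<bar>\<alpha>\<bar> \<le> A"
    using intercept_bound[of "exp v" u] by auto
  have "\<forall>\<^sub>F x in at_top. 1 - \<eta> < \<rho> x"
    using order_tendstoD(1)[OF rho_lim, of "1 - \<eta>"] \<eta>(1) by simp
  then obtain B where "\<And>x. B \<le> x \<Longrightarrow> 1 - \<eta> < \<rho> x"
    by (auto simp: eventually_at_top_linorder)
  then have B: "1 - \<eta> < \<rho> (max 0 B)"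
    by simp
  \<comment> \<open>For every fit with \<bar>\<alpha>\<bar> \<le> \<open>A\<close>, slope shorter
    than \<open>u\<close> and scale at most \<open>exp v\<close>, the outlier's scaled residual must
    reach \<open>max 0 B\<close>. As
    \<open>\<theta>\<^sub>1 \<bullet> (\<theta>\<^sub>1 - \<theta>)\<close> is at least
    \<open>t * (t - u)\<close>, this \<open>k\<close> suffices and also absorbs both
    intercepts.\<close>
  define k where "k = (\<bar>\<alpha>\<^sub>1\<bar> + \<bar>A\<bar> + max 0 B * exp v) / (t * (t - u))"
  have k: "0 \<le> k" "k * (t * (t - u)) = \<bar>\<alpha>\<^sub>1\<bar> + \<bar>A\<bar> + max 0 B * exp v"
    using t by (auto simp: k_def)
  define p where "p = (\<alpha>\<^sub>1 + k * (\<theta>\<^sub>1 \<bullet> \<theta>\<^sub>1), k *\<^sub>R \<theta>\<^sub>1)"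
  define Hs where "Hs = return borel p"
  have Hs: "prob_space Hs" "sets Hs = sets borel"
    by (simp_all add: Hs_def prob_space_return)
  have Hs_loss: "mean_loss \<rho> Hs (\<alpha>, \<theta>, s) = \<rho> ((\<alpha>\<^sub>1 - \<alpha> + k * (\<theta>\<^sub>1 \<bullet> (\<theta>\<^sub>1 - \<theta>))) / s)" for \<alpha> \<theta> s
  proof -
    have "mean_loss \<rho> Hs (\<alpha>, \<theta>, s) = (case p of (y, x) \<Rightarrow> \<rho> ((y - \<alpha> - x \<bullet> \<theta>) / s))"
      unfolding mean_loss_def Hs_def prod.case
      by (rule integral_return) (simp_all add: rho_resid_measurable)
    then show ?thesis
      by (simp add: p_def algebra_simps)
  qed
  note D = feasible_contaminatedD[OF Hs] and loss = mean_loss_contaminated[OF Hs]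
  have large: "v \<le> CM_objective \<rho> c (mixture \<epsilon> Ho Hs) (\<alpha>, \<theta>, s)"
    if w: "(\<alpha>, \<theta>, s) \<in> CM_feasible \<rho> b (mixture \<epsilon> Ho Hs)" and \<theta>: "norm \<theta> < u" for \<alpha> \<theta> s
  proof (rule ccontr)
    assume *: "\<not> ?thesis"
    note D = D[OF w]
    have s: "s \<le> exp v"
      using D(1,4) * by (metis exp_ln exp_le_cancel_iff linorder_not_less order_trans less_imp_le)
    have \<alpha>: "\<bar>\<alpha>\<bar> \<le> A"
      using A[OF _ D(1) s D(2)] \<theta> by simp
    have "\<theta>\<^sub>1 \<bullet> \<theta> \<le> t * u"
      using norm_cauchy_schwarz[of \<theta>\<^sub>1 \<theta>] mult_left_mono[of "norm \<theta>" u t] \<theta> t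
      unfolding 1(1) by linarith
    then have "t * (t - u) \<le> \<theta>\<^sub>1 \<bullet> (\<theta>\<^sub>1 - \<theta>)"
      using 1(1) by (simp add: inner_diff_right dot_square_norm power2_eq_square right_diff_distrib)
    then have "k * (t * (t - u)) \<le> k * (\<theta>\<^sub>1 \<bullet> (\<theta>\<^sub>1 - \<theta>))"
      using k(1) by (rule mult_left_mono)
    then have "max 0 B * exp v \<le> \<alpha>\<^sub>1 - \<alpha> + k * (\<theta>\<^sub>1 \<bullet> (\<theta>\<^sub>1 - \<theta>))"
      using k(2) \<alpha> by linarith
    moreover have "max 0 B * s \<le> max 0 B * exp v"
      using s by (intro mult_left_mono) auto
    ultimately have "max 0 B \<le> (\<alpha>\<^sub>1 - \<alpha> + k * (\<theta>\<^sub>1 \<bullet> (\<theta>\<^sub>1 - \<theta>))) / s"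
      unfolding pos_le_divide_eq[OF D(1)] by linarith
    then have "1 - \<eta> \<le> mean_loss \<rho> Hs (\<alpha>, \<theta>, s)"
      unfolding Hs_loss by (intro order_trans[OF less_imp_le[OF B]] rho_mono) linarith
    then have "\<epsilon> * (1 - \<eta>) \<le> \<epsilon> * mean_loss \<rho> Hs (\<alpha>, \<theta>, s)"
      using eps_pos by (intro mult_left_mono) auto
    moreover have "(1 - \<epsilon>) * K 0 s \<le> (1 - \<epsilon>) * G \<alpha> \<theta> s"
      using eps_less_1 K_0_le_G[OF D(1)] by (intro mult_left_mono) auto
    \<comment> \<open>This comparison works twice: feasibility passes down to the expression in
      \<open>\<eta>(3)\<close>, and the resulting lower bound \<open>v\<close> passes back up to the
      objective.\<close>
    ultimately have le: "(1 - \<epsilon>) * K 0 s + \<epsilon> * (1 - \<eta>) \<le> mean_loss \<rho> (mixture \<epsilon> Ho Hs) (\<alpha>, \<theta>, s)"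
      by (simp add: loss)
    then have "v \<le> c * ((1 - \<epsilon>) * K 0 s + \<epsilon> * (1 - \<eta>)) + ln s"
      using w by (intro \<eta>(3)) (auto simp: CM_feasible_def)
    also have "\<dots> \<le> CM_objective \<rho> c (mixture \<epsilon> Ho Hs) (\<alpha>, \<theta>, s)"
      using mult_left_mono[OF le less_imp_le[OF c_pos]] by (simp add: CM_objective_def)
    finally show False using * by simp
  qed
  \<comment> \<open>The point mass has residual 0 from this fit, so the contamination adds nothing
    to its loss.\<close>
  have w0: "(\<alpha>\<^sub>1, \<theta>\<^sub>1, s\<^sub>1) \<in> CM_feasible \<rho> b (mixture \<epsilon> Ho Hs)"
      "CM_objective \<rho> c (mixture \<epsilon> Ho Hs) (\<alpha>\<^sub>1, \<theta>\<^sub>1, s\<^sub>1) < v"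
    using 1 by (auto simp: CM_feasible_def CM_objective_def loss Hs_loss)
  show ?thesis
  proof (rule that[OF Hs], rule ccontr)
    fix \<alpha> \<theta> s
    assume z: "CM_solution \<rho> b c (mixture \<epsilon> Ho Hs) (\<alpha>, \<theta>, s)" and \<theta>: "\<not> u \<le> norm \<theta>"
    have op: "open {w :: real \<times> (real ^ 'p) \<times> real. norm (fst (snd w)) < u}"
      by (intro open_Collect_less continuous_intros)
    obtain w where "norm (fst (snd w)) < u" "w \<in> CM_feasible \<rho> b (mixture \<epsilon> Ho Hs)"
        "CM_objective \<rho> c (mixture \<epsilon> Ho Hs) w < v"
      by (rule CM_solution_approx[OF z op _ w0]) (use \<theta> in auto)
    then show False
      using large by (cases w) force
  qed
qed

text \<open>Uniqueness of the root \<open>t\<close> sharpens the monotonicity of \<open>m_CM\<close>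
  to strict inequalities with \<open>r_CM\<close> on both sides of \<open>t\<close>. Those above
  bound all solutions, and those below supply contaminations with bias near
  \<open>t\<close>.\<close>

lemma max_bias_CM:
  assumes T: "CM_slope_estimate \<rho> b c T"
    and ex1: "\<exists>!t. 0 \<le> t \<and> m_CM \<rho> b c Ho \<epsilon> t = r_CM \<rho> b c Ho \<epsilon>"
  shows "max_bias Ho T \<epsilon> = ereal (m_CM_inv \<rho> b c Ho \<epsilon> (r_CM \<rho> b c Ho \<epsilon>))"
proof -
  define t where "t = m_CM_inv \<rho> b c Ho \<epsilon> (r_CM \<rho> b c Ho \<epsilon>)"
  have t: "0 \<le> t" "m_CM \<rho> b c Ho \<epsilon> t = r_CM \<rho> b c Ho \<epsilon>"
    using theI'[OF ex1] unfolding t_def m_CM_inv_def by auto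
  have below: "m_CM \<rho> b c Ho \<epsilon> u < r_CM \<rho> b c Ho \<epsilon>" if "0 \<le> u" "u < t" for u
    using m_CM_mono[of u t] t ex1 that by (metis less_imp_le order_le_less less_irrefl)
  have above: "r_CM \<rho> b c Ho \<epsilon> < m_CM \<rho> b c Ho \<epsilon> u" if "t < u" for u
    using m_CM_mono[of t u] t ex1 that by (metis less_imp_le order_le_less less_irrefl order_trans)
  have T': "case T (mixture \<epsilon> Ho Hs) of
        None \<Rightarrow> \<not> (\<exists>z. CM_solution \<rho> b c (mixture \<epsilon> Ho Hs) z)
      | Some \<theta> \<Rightarrow> \<exists>\<alpha> s. CM_solution \<rho> b c (mixture \<epsilon> Ho Hs) (\<alpha>, \<theta>, s)"
    if "prob_space Hs" "sets Hs = sets borel" for Hs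
    using T prob_space_mixture[OF prob_space_Ho that(1)] that eps_pos eps_less_1
    unfolding CM_slope_estimate_def by simp
  have "max_bias Ho T \<epsilon> \<le> ereal t"
    unfolding max_bias_def
  proof (rule SUP_least)
    fix H assume "H \<in> contam_nbhd Ho \<epsilon>"
    then obtain Hs where H: "H = mixture \<epsilon> Ho Hs" and Hs: "prob_space Hs" "sets Hs = sets borel"
      by (auto simp: contam_nbhd_def)
    have "\<exists>z. CM_solution \<rho> b c H z"
      unfolding H using solution_exists[OF Hs, of "t + 1"] above[of "t + 1"] t(1) by simp
    then obtain \<theta> \<alpha> s where \<theta>: "T H = Some \<theta>" "CM_solution \<rho> b c H (\<alpha>, \<theta>, s)"
      using T'[OF Hs] by (auto simp: H split: option.splits)
    have "norm \<theta> \<le> t"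
    proof (rule dense_ge)
      fix u assume "t < u"
      then show "norm \<theta> \<le> u"
        using solution_slope_le[OF Hs, of u] above t(1) \<theta>(2) unfolding H by simp
    qed
    then show "asym_bias T H \<le> ereal t"
      by (simp add: asym_bias_def \<theta>(1))
  qed
  moreover have "ereal t \<le> max_bias Ho T \<epsilon>"
  proof (rule ccontr)
    assume "\<not> ?thesis"
    then obtain u where u: "max_bias Ho T \<epsilon> < ereal u" "u < t"
      using ereal_dense2[of "max_bias Ho T \<epsilon>" "ereal t"] by (auto simp: not_le)
    have bias: "asym_bias T (mixture \<epsilon> Ho Hs) < ereal u" if "prob_space Hs" "sets Hs = sets borel" for Hs
    proof -
      have "asym_bias T (mixture \<epsilon> Ho Hs) \<le> max_bias Ho T \<epsilon>"
        unfolding max_bias_def by (rule SUP_upper) (use that in \<open>auto simp: contam_nbhd_def\<close>)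
      then show ?thesis using u(1) by simp
    qed
    \<comment> \<open>Any one contaminated distribution shows that the maximum bias is nonnegative,
      which gives \<open>0 \<le> u\<close>.\<close>
    have "0 \<le> asym_bias T (mixture \<epsilon> Ho (return borel 0))"
      by (simp add: asym_bias_def split: option.split)
    also have "\<dots> < ereal u"
      by (rule bias) (simp_all add: prob_space_return)
    finally have "0 \<le> u" by simp
    \<comment> \<open>The construction needs a slope norm strictly above \<open>u\<close> at which
      \<open>m_CM\<close> is still below \<open>r_CM\<close>.\<close>
    define u' where "u' = (u + t) / 2"
    have "u < u'" "u' < t"
      using u(2) by (auto simp: u'_def)
    then obtain Hs where Hs: "prob_space Hs" "sets Hs = sets borel"
      "\<And>\<alpha> \<theta> s. CM_solution \<rho> b c (mixture \<epsilon> Ho Hs) (\<alpha>, \<theta>, s) \<Longrightarrow> u \<le> norm \<theta>"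
      using least_favourable_contamination[of u u'] below[of u'] \<open>0 \<le> u\<close> by auto
    \<comment> \<open>At this distribution the functional is undefined, with infinite bias, or has
      norm at least \<open>u\<close>; both contradict a bias below \<open>u\<close>.\<close>
    then show False
      using bias[OF Hs(1,2)] T'[OF Hs(1,2)] by (fastforce simp: asym_bias_def split: option.splits)
  qed
  ultimately show ?thesis
    unfolding t_def by (rule antisym)
qed

end

theorem theorem3p2:
  fixes \<rho> :: "real \<Rightarrow> real" and b c \<epsilon> :: real
    and Fo :: "real measure" and Go :: "(real ^ 'p) measure"
    and Ho :: "(real \<times> (real ^ 'p)) measure"
    and T_CM :: "('p::finite) functional"
  assumes "0 < b" "b < 1" "0 < c"
    and "A3 \<rho>"
    and "prob_space Fo" "A1 Fo"
    and "prob_space Go" "sets Go = sets borel" "A2 Go"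
    and "Ho = Fo \<Otimes>\<^sub>M Go"
    and "0 < \<epsilon>" "\<epsilon> < min b (1 - b)"
    and "CM_slope_estimate \<rho> b c T_CM"
    and inverse_exists: "\<exists>!t. 0 \<le> t \<and> m_CM \<rho> b c Ho \<epsilon> t = r_CM \<rho> b c Ho \<epsilon>"
  shows "max_bias Ho T_CM \<epsilon> = ereal (m_CM_inv \<rho> b c Ho \<epsilon> (r_CM \<rho> b c Ho \<epsilon>))"
proof -
  interpret Fo: prob_space Fo by fact
  interpret Go: prob_space Go by fact
  interpret CM_model \<rho> Fo Go b c \<epsilon> Ho
    by unfold_locales (use assms in auto)
  show ?thesis
    by (rule max_bias_CM) fact+
qed

end
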